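(* The Tutte polynomial is a valuative invariant that is valuatively universal within the class of elementary split matroids.
   Context: $\mathsf{U}_{r,m}$ denotes the uniform matroid of rank $r$ on $m$ elements. A matroid is elementary split if it has no minor isomorphic to $\mathsf{U}_{0,1}\oplus\mathsf{U}_{1,2}\oplus\mathsf{U}_{1,1}$. For a finite set $E$, $\mathcal{M}_{E,k}$ is the set of matroids on $E$ of rank $k$; $\mathcal{M}_{n,k}=\mathcal{M}_{[n],k}$ and $\mathcal{M}=\bigsqcup_{0\le k\le n}\mathcal{M}_{n,k}$. The base polytope $\mathscr{P}(\mathsf{M})\subseteq\mathbb{R}^E$ is the convex hull of the indicator vectors of the bases. For an abelian group $A$, a map $f:\mathcal{M}_{E,k}\to A$ is valuative if $\sum_i a_i f(\mathsf{M}_i)=0$ whenever $a_i\in\mathbb{Z}$ and $\sum_i a_i\mathbb{1}_{\mathscr{P}(\mathsf{M}_i)}\equiv 0$ on $\mathbb{R}^E$. A valuative invariant is a map $f:\mathcal{M}\to A$ which is valuative on each $\mathcal{M}_{n,k}$ and isomorphism-invariant. For a class $\mathcal{C}\subseteq\mathcal{M}$, $\mathcal{C}_{n,k}=\mathcal{C}\cap\mathcal{M}_{n,k}$. A valuative invariant $u:\mathcal{M}\to A$ is valuatively universal within $\mathcal{C}$ if for every valuative invariant $f:\mathcal{M}\to A'$ and every $0\le k\le n$ there is a homomorphism $\widehat f_{n,k}:A\to A'$ with $f(\mathsf{M})=\widehat f_{n,k}(u(\mathsf{M}))$ for all $\mathsf{M}\in\mathcal{C}_{n,k}$. The Tutte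 polynomial is viewed as the map $T:\mathcal{M}\to\mathbb{Z}[x,y]$. *)

theory Defs
  imports "HOL-Analysis.Analysis" "HOL-Computational_Algebra.Polynomial"
begin

definition is_matroid :: "nat \<Rightarrow> nat set set \<Rightarrow> bool" where
  "is_matroid n B \<longleftrightarrow> B \<subseteq> Pow {0..<n} \<and> B \<noteq> {} \<and>
     (\<forall>B1\<in>B. \<forall>B2\<in>B. \<forall>e\<in>B1 - B2. \<exists>f\<in>B2 - B1. insert f (B1 - {e}) \<in> B)"

definition matroids :: "nat \<Rightarrow> nat \<Rightarrow> nat set set set" where
  "matroids n k = {B. is_matroid n B \<and> (\<forall>b\<in>B. card b = k)}"

definition mrank :: "nat set set \<Rightarrow> nat set \<Rightarrow> nat" where
  "mrank B X = Max ((\<lambda>b. card (b \<inter> X)) ` B)"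

text \<open>Base polytope in R^[n] (vectors are functions nat => real vanishing outside [n]):
  the convex hull of the indicator vectors of the bases, written out explicitly.\<close>
definition base_polytope :: "nat set set \<Rightarrow> (nat \<Rightarrow> real) set" where
  "base_polytope B = {x. \<exists>l :: nat set \<Rightarrow> real. (\<forall>b\<in>B. l b \<ge> 0) \<and> (\<Sum>b\<in>B. l b) = 1 \<and>
       (\<forall>i. x i = (\<Sum>b\<in>B. l b * indicator b i))}"

definition zsmul :: "int \<Rightarrow> 'a::ab_group_add \<Rightarrow> 'a" where
  "zsmul a v = (if 0 \<le> a then (\<Sum>_<nat a. v) else - (\<Sum>_<nat (- a). v))"

definition valuative_on :: "nat \<Rightarrow> nat \<Rightarrow> (nat set set \<Rightarrow> 'a::ab_group_add) \<Rightarrow> bool" where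
  "valuative_on n k f \<longleftrightarrow>
     (\<forall>ms :: (int \<times> nat set set) list.
        (\<forall>(a, B)\<in>set ms. B \<in> matroids n k) \<longrightarrow>
        (\<forall>x :: nat \<Rightarrow> real. (\<forall>i\<ge>n. x i = 0) \<longrightarrow>
            (\<Sum>(a, B)\<leftarrow>ms. real_of_int a * indicator (base_polytope B) x) = 0) \<longrightarrow>
        (\<Sum>(a, B)\<leftarrow>ms. zsmul a (f B)) = 0)"

definition valuative_invariant :: "(nat \<Rightarrow> nat set set \<Rightarrow> 'a::ab_group_add) \<Rightarrow> bool" where
  "valuative_invariant f \<longleftrightarrow>
     (\<forall>n k. k \<le> n \<longrightarrow> valuative_on n k (f n)) \<and>
     (\<forall>n B \<sigma>. is_matroid n B \<longrightarrow> bij_betw \<sigma> {0..<n} {0..<n} \<longrightarrow>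
        f n ((\<lambda>b. \<sigma> ` b) ` B) = f n B)"

text \<open>The matroid U_{0,1} + U_{1,2} + U_{1,1} on {0,1,2,3}: 0 is a loop, 1,2 parallel, 3 a coloop.\<close>
definition W_bases :: "nat set set" where
  "W_bases = {{1,3},{2,3}}"

text \<open>M (on [n]) has a minor M/C\D isomorphic to the matroid on {0..<m} with bases BN;
  the minor is described by its rank function r(X) = r_M(X \<union> C) - r_M(C).\<close>
definition has_minor_iso :: "nat \<Rightarrow> nat set set \<Rightarrow> nat \<Rightarrow> nat set set \<Rightarrow> bool" where
  "has_minor_iso n B m BN \<longleftrightarrow>
     (\<exists>C D \<sigma>. C \<subseteq> {0..<n} \<and> D \<subseteq> {0..<n} \<and> C \<inter> D = {} \<and>
        bij_betw \<sigma> {0..<m} ({0..<n} - (C \<union> D)) \<and>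
        (\<forall>X\<subseteq>{0..<m}. mrank B (\<sigma> ` X \<union> C) - mrank B C = mrank BN X))"

definition elementary_split :: "nat \<Rightarrow> nat set set \<Rightarrow> bool" where
  "elementary_split n B \<longleftrightarrow> \<not> has_minor_iso n B 4 W_bases"

text \<open>Tutte polynomial in Z[x,y], represented as int poly poly: outer variable y,
  coefficients polynomials in x.
  T(x,y) = sum over A \<subseteq> E of (x-1)^(r(E)-r(A)) (y-1)^(|A|-r(A)).\<close>
definition tutte :: "nat \<Rightarrow> nat set set \<Rightarrow> int poly poly" where
  "tutte n B = (\<Sum>A\<in>Pow {0..<n}.
      [: [:-1, 1:] ^ (mrank B {0..<n} - mrank B A) :] * [: -1, 1 :] ^ (card A - mrank B A))"

definition valuatively_universal_within ::
  "(nat \<Rightarrow> nat set set \<Rightarrow> 'a::ab_group_add) \<Rightarrow> (nat \<Rightarrow> nat set set \<Rightarrow> bool)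
     \<Rightarrow> (nat \<Rightarrow> nat set set \<Rightarrow> 'b::ab_group_add) \<Rightarrow> bool" where
  "valuatively_universal_within u C f \<longleftrightarrow>
     (\<forall>n k. k \<le> n \<longrightarrow> (\<exists>h :: 'a \<Rightarrow> 'b. (\<forall>p q. h (p + q) = h p + h q) \<and>
        (\<forall>B\<in>matroids n k. C n B \<longrightarrow> f n B = h (u n B))))"

end

theory Submission
  imports Defs
begin

text \<open>
  Universality. In an elementary split matroid of rank \<open>k\<close>, any two distinct cyclic flats \<open>H\<close>, \<open>H'\<close>
  that are dependent and not spanning satisfy \<open>|H \<inter> H'| + k \<le> r H + r H'\<close>; otherwise the
  forbidden minor appears. Hence a point of the hypersimplex violates at most one of the
  inequalities \<open>x(H) \<le> r H\<close>, which together cut out the base polytope. So the indicator function of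
  the base polytope is that of the hypersimplex minus one correction for each \<open>H\<close>, and every valuative
  invariant is a sum of terms depending only on the pairs \<open>(r H, |H|)\<close>. By the same argument each
  set of positive corank \<open>j\<close> and nullity \<open>i\<close> is accounted for by exactly one \<open>H\<close>, so the coefficient of
  \<open>(x - 1)^j (y - 1)^i\<close> in the Tutte polynomial is a sum over \<open>H\<close>. The coefficient at
  \<open>(k - r H, |H| - r H)\<close> contributed by \<open>H\<close> itself is \<open>1\<close>, which makes the system unitriangular over
  the integers, so that the multiplicities of the pairs \<open>(r H, |H|)\<close> can be recovered.

  Valuativity. The event \<open>m \<le> r A\<close> says that the base polytope meets the half-space \<open>x(A) \<ge> m\<close>,
  and non-emptiness of compact convex sets is the Euler characteristic, a valuation.
\<close>

section \<open>Rank function\<close>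

locale matroid_on =
  fixes n k :: nat and B :: "nat set set"
  assumes bases: "B \<in> matroids n k"
begin

abbreviation "E \<equiv> {0..<n}"
abbreviation "r \<equiv> mrank B"

lemma basis_subset: "b \<in> B \<Longrightarrow> b \<subseteq> E"
  using bases by (auto simp: matroids_def is_matroid_def)

lemma card_basis: "b \<in> B \<Longrightarrow> card b = k"
  using bases by (auto simp: matroids_def)

lemma finite_basis: "b \<in> B \<Longrightarrow> finite b"
  using basis_subset finite_subset by blast

lemma finite_bases: "finite B"
proof -
  have "B \<subseteq> Pow E" using basis_subset by blast
  thus ?thesis by (rule finite_subset) simp
qed

lemma bases_nonempty: "B \<noteq> {}"
  using bases by (auto simp: matroids_def is_matroid_def)

lemma basis_exchange:
  assumes "b1 \<in> B" "b2 \<in> B" "e \<in> b1 - b2"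
  obtains f where "f \<in> b2 - b1" "insert f (b1 - {e}) \<in> B"
proof -
  have "\<forall>b1\<in>B. \<forall>b2\<in>B. \<forall>e\<in>b1 - b2. \<exists>f\<in>b2 - b1. insert f (b1 - {e}) \<in> B"
    using bases by (simp add: matroids_def is_matroid_def)
  thus ?thesis using assms that by fast
qed

lemma card_le_mrank: "b \<in> B \<Longrightarrow> card (b \<inter> X) \<le> r X"
  unfolding mrank_def using finite_bases by (intro Max_ge) auto

lemma mrank_attained:
  obtains b where "b \<in> B" "card (b \<inter> X) = r X"
proof -
  have "r X \<in> (\<lambda>b. card (b \<inter> X)) ` B"
    unfolding mrank_def using finite_bases bases_nonempty by (intro Max_in) auto
  thus ?thesis using that by auto
qed

lemma mrank_leI: "(\<And>b. b \<in> B \<Longrightarrow> card (b \<inter> X) \<le> m) \<Longrightarrow> r X \<le> m"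
  by (rule mrank_attained[of X]) force

lemma mrank_le_card: "finite X \<Longrightarrow> r X \<le> card X"
  by (intro mrank_leI card_mono) auto

lemma mrank_mono: "X \<subseteq> Y \<Longrightarrow> r X \<le> r Y"
proof (rule mrank_leI)
  fix b assume "X \<subseteq> Y" "b \<in> B"
  hence "card (b \<inter> X) \<le> card (b \<inter> Y)" using finite_basis by (intro card_mono) auto
  thus "card (b \<inter> X) \<le> r Y" using card_le_mrank[OF \<open>b \<in> B\<close>, of Y] by simp
qed

lemma mrank_le: "r X \<le> k"
proof (rule mrank_leI)
  fix b assume "b \<in> B"
  thus "card (b \<inter> X) \<le> k" using card_mono[of b "b \<inter> X"] finite_basis card_basis by auto
qed

lemma mrank_ground: "r E = k"
proof -
  obtain b where b: "b \<in> B" using bases_nonempty by blast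
  hence "b \<inter> E = b" using basis_subset by blast
  hence "k \<le> r E" using card_le_mrank[OF b, of E] card_basis[OF b] by simp
  thus ?thesis using mrank_le[of E] by simp
qed

lemma mrank_Un_le: "finite Y \<Longrightarrow> r (X \<union> Y) \<le> r X + card (Y - X)"
proof (rule mrank_leI)
  fix b assume Y: "finite Y" and b: "b \<in> B"
  have "card (b \<inter> (X \<union> Y)) \<le> card ((b \<inter> X) \<union> (Y - X))"
    using Y b finite_basis by (intro card_mono) auto
  also have "\<dots> \<le> card (b \<inter> X) + card (Y - X)" by (rule card_Un_le)
  also have "\<dots> \<le> r X + card (Y - X)" using card_le_mrank[OF b] by simp
  finally show "card (b \<inter> (X \<union> Y)) \<le> r X + card (Y - X)" .
qed

lemma mrank_insert_le: "r (insert e X) \<le> Suc (r X)"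
proof -
  have "r (X \<union> {e}) \<le> r X + card ({e} - X)" by (rule mrank_Un_le) simp
  also have "card ({e} - X) \<le> card {e}" by (rule card_mono) auto
  finally show ?thesis by simp
qed

text \<open>Bases have equal size, so a smaller trace on \<open>Y\<close> gives \<open>b1\<close>
  some \<open>e\<close> outside both \<open>b2\<close> and \<open>Y\<close>. Exchanging
  \<open>e\<close> for \<open>f\<close> either enlarges the trace (\<open>f\<close> in
  \<open>Y\<close>) or keeps it and brings \<open>b1\<close> closer to \<open>b2\<close>.\<close>

lemma basis_augment:
  assumes "b1 \<in> B" "b2 \<in> B" "card (b1 \<inter> Y) < card (b2 \<inter> Y)"
  shows "\<exists>b\<in>B. b1 \<inter> Y \<subset> b \<inter> Y"
  using assms
proof (induction "card (b1 - b2)" arbitrary: b1 rule: less_induct)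
  case less
  have fin: "finite b1" "finite b2" using less.prems finite_basis by auto
  have "\<not> b1 - Y \<subseteq> b2 - Y"
  proof
    assume "b1 - Y \<subseteq> b2 - Y"
    hence "card (b1 - Y) \<le> card (b2 - Y)" using fin by (intro card_mono) auto
    moreover have "card (b1 \<inter> Y) + card (b1 - Y) = k" "card (b2 \<inter> Y) + card (b2 - Y) = k"
      using fin less.prems card_basis by (metis card_Int_Diff)+
    ultimately show False using less.prems by linarith
  qed
  then obtain e where e: "e \<in> b1 - b2" "e \<notin> Y" by blast
  obtain f where f: "f \<in> b2 - b1" "insert f (b1 - {e}) \<in> B"
    using basis_exchange less.prems(1,2) e(1) by blast
  show ?case
  proof (cases "f \<in> Y")
    case True
    hence "b1 \<inter> Y \<subset> insert f (b1 - {e}) \<inter> Y" using e f by blast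
    thus ?thesis using f by blast
  next
    case False
    hence eq: "insert f (b1 - {e}) \<inter> Y = b1 \<inter> Y" using e by blast
    have "insert f (b1 - {e}) - b2 = b1 - b2 - {e}" using f(1) by auto
    hence "insert f (b1 - {e}) - b2 \<subset> b1 - b2" using e(1) by auto
    hence "card (insert f (b1 - {e}) - b2) < card (b1 - b2)"
      using fin by (intro psubset_card_mono) auto
    from less.hyps[OF this f(2) less.prems(2)] show ?thesis
      using less.prems(3) eq by simp
  qed
qed

text \<open>A basis of largest trace on \<open>Y\<close> among those containing
  \<open>b \<inter> Y\<close> attains the rank, since \<open>basis_augment\<close> would otherwise
  improve it.\<close>

lemma basis_extend:
  assumes b: "b \<in> B"
  obtains b' where "b' \<in> B" "b \<inter> Y \<subseteq> b'" "card (b' \<inter> Y) = r Y"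
proof -
  let ?S = "{b' \<in> B. b \<inter> Y \<subseteq> b'}"
  have "finite ?S" "?S \<noteq> {}" using b finite_bases by auto
  then obtain b' where b': "b' \<in> ?S" and "card (b' \<inter> Y) = Max ((\<lambda>c. card (c \<inter> Y)) ` ?S)"
    by (rule obtains_MAX[where f = "\<lambda>c. card (c \<inter> Y)"]) simp
  hence max: "\<And>c. c \<in> ?S \<Longrightarrow> card (c \<inter> Y) \<le> card (b' \<inter> Y)"
    using \<open>finite ?S\<close> by simp
  have "card (b' \<inter> Y) = r Y"
  proof (rule ccontr)
    assume "card (b' \<inter> Y) \<noteq> r Y"
    moreover obtain b2 where "b2 \<in> B" "card (b2 \<inter> Y) = r Y" by (rule mrank_attained)
    ultimately obtain c where c: "c \<in> B" "b' \<inter> Y \<subset> c \<inter> Y"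
      using basis_augment[of b' b2 Y] b' card_le_mrank[of b' Y] by force
    hence "card (b' \<inter> Y) < card (c \<inter> Y)" using finite_basis by (intro psubset_card_mono) auto
    moreover have "c \<in> ?S" using c b' by blast
    ultimately show False using max by force
  qed
  thus ?thesis using b' that by blast
qed

text \<open>A single basis \<open>c\<close> serves both ranks on the left: extend a basis optimal on
  the intersection to one optimal on the union, then use modularity of cardinality on
  \<open>c\<close>.\<close>

lemma mrank_submodular: "r (X \<union> Y) + r (X \<inter> Y) \<le> r X + r Y"
proof -
  obtain b where b: "b \<in> B" "card (b \<inter> (X \<inter> Y)) = r (X \<inter> Y)" by (rule mrank_attained)
  obtain c where c: "c \<in> B" "b \<inter> (X \<union> Y) \<subseteq> c" "card (c \<inter> (X \<union> Y)) = r (X \<union> Y)"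
    using basis_extend[OF b(1)] by blast
  have fin: "finite c" using c finite_basis by blast
  have "card (b \<inter> (X \<inter> Y)) \<le> card (c \<inter> (X \<inter> Y))" using c fin by (intro card_mono) auto
  moreover have "card (c \<inter> (X \<union> Y)) + card (c \<inter> (X \<inter> Y)) = card (c \<inter> X) + card (c \<inter> Y)"
    using card_Un_Int[of "c \<inter> X" "c \<inter> Y"] fin by (simp add: Int_Un_distrib Int_assoc Int_left_commute)
  ultimately show ?thesis
    using b(2) c(3) card_le_mrank[OF c(1), of X] card_le_mrank[OF c(1), of Y] by linarith
qed

text \<open>Monotonicity of closure, by submodularity for \<open>Y\<close> and
  \<open>insert e X\<close>. The contrapositive is used too: an element not spanned by
  \<open>Y\<close> is not spanned by \<open>X\<close>.\<close>

lemma mrank_insert_eq_mono: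
  assumes "X \<subseteq> Y" "r (insert e X) = r X"
  shows "r (insert e Y) = r Y"
proof (cases "e \<in> Y")
  case False
  hence "Y \<union> insert e X = insert e Y" "Y \<inter> insert e X = X" using assms by auto
  thus ?thesis using mrank_submodular[of Y "insert e X"] assms(2) mrank_mono[of Y "insert e Y"]
    by (simp add: le_antisym subset_insertI)
qed (simp add: insert_absorb)

end

section \<open>Edmonds' description of the base polytope\<close>

lemma base_polytope_convex:
  assumes "x \<in> base_polytope B" "y \<in> base_polytope B" "0 \<le> u" "0 \<le> v" "u + v = 1"
  shows "(\<lambda>i. u * x i + v * y i) \<in> base_polytope B"
proof -
  obtain l where l: "\<forall>b\<in>B. l b \<ge> 0" "(\<Sum>b\<in>B. l b) = 1" "\<forall>i. x i = (\<Sum>b\<in>B. l b * indicator b i)"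
    using assms(1) unfolding base_polytope_def by blast
  obtain m where m: "\<forall>b\<in>B. m b \<ge> 0" "(\<Sum>b\<in>B. m b) = 1" "\<forall>i. y i = (\<Sum>b\<in>B. m b * indicator b i)"
    using assms(2) unfolding base_polytope_def by blast
  have "(\<Sum>b\<in>B. u * l b + v * m b) = 1"
    using l(2) m(2) assms(5) by (simp add: sum.distrib flip: sum_distrib_left)
  moreover have "\<forall>i. u * x i + v * y i = (\<Sum>b\<in>B. (u * l b + v * m b) * indicator b i)"
    using l(3) m(3) by (simp add: sum.distrib sum_distrib_left algebra_simps)
  ultimately show ?thesis
    unfolding base_polytope_def using l(1) m(1) assms(3,4)
    by (intro CollectI exI[of _ "\<lambda>b. u * l b + v * m b"]) auto
qed

lemma sum_indicator_card: "finite A \<Longrightarrow> sum (indicat_real b) A = real (card (b \<inter> A))"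
  by (induction A rule: finite_induct) (auto simp: Int_insert_right)

context matroid_on
begin

definition rank_polytope :: "(nat \<Rightarrow> real) set" where
  "rank_polytope = {x. (\<forall>i. 0 \<le> x i) \<and> (\<forall>i\<ge>n. x i = 0) \<and>
     (\<forall>A\<subseteq>E. sum x A \<le> r A) \<and> sum x E = k}"

lemma rank_polytope_le: "x \<in> rank_polytope \<Longrightarrow> A \<subseteq> E \<Longrightarrow> sum x A \<le> r A"
  unfolding rank_polytope_def by blast

lemma rank_polytope_le_1: "x \<in> rank_polytope \<Longrightarrow> x i \<le> 1"
proof (cases "i < n")
  case True
  assume "x \<in> rank_polytope"
  hence "sum x {i} \<le> r {i}" using True by (intro rank_polytope_le) auto
  thus ?thesis using mrank_le_card[of "{i}"] by simp
qed (simp add: rank_polytope_def)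

lemma base_sum_eq:
  assumes "\<forall>i. x i = (\<Sum>b\<in>B. l b * indicator b i)" "finite A"
  shows "sum x A = (\<Sum>b\<in>B. l b * real (card (b \<inter> A)))"
proof -
  have "sum x A = (\<Sum>b\<in>B. \<Sum>i\<in>A. l b * indicator b i)"
    using assms(1) by (simp add: sum.swap[of _ B A])
  also have "\<dots> = (\<Sum>b\<in>B. l b * real (card (b \<inter> A)))"
    using assms(2) by (simp add: sum_indicator_card flip: sum_distrib_left)
  finally show ?thesis .
qed

lemma base_polytope_subset: "base_polytope B \<subseteq> rank_polytope"
proof
  fix x assume "x \<in> base_polytope B"
  then obtain l where l: "\<forall>b\<in>B. l b \<ge> 0" "(\<Sum>b\<in>B. l b) = 1" "\<forall>i. x i = (\<Sum>b\<in>B. l b * indicator b i)"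
    unfolding base_polytope_def by blast
  have "0 \<le> x i" for i using l by (auto intro!: sum_nonneg)
  moreover have "x i = 0" if "i \<ge> n" for i
  proof -
    have "\<forall>b\<in>B. i \<notin> b" using basis_subset that by fastforce
    thus ?thesis using l(3) by simp
  qed
  moreover have "sum x A \<le> r A" if "A \<subseteq> E" for A
  proof -
    have "finite A" using that finite_subset by blast
    hence "sum x A = (\<Sum>b\<in>B. l b * real (card (b \<inter> A)))" using base_sum_eq l(3) by blast
    also have "\<dots> \<le> (\<Sum>b\<in>B. l b * real (r A))"
      using l(1) card_le_mrank by (intro sum_mono mult_left_mono) auto
    also have "\<dots> = r A" using l(2) by (simp flip: sum_distrib_right)
    finally show ?thesis .
  qed
  moreover have "sum x E = k"
  proof -
    have "sum x E = (\<Sum>b\<in>B. l b * real (card (b \<inter> E)))" using base_sum_eq l(3) by blast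
    also have "\<dots> = (\<Sum>b\<in>B. l b * real k)"
      using basis_subset card_basis by (intro sum.cong) (auto simp: Int_absorb2)
    also have "\<dots> = k" using l(2) by (simp flip: sum_distrib_right)
    finally show ?thesis .
  qed
  ultimately show "x \<in> rank_polytope" unfolding rank_polytope_def by blast
qed

text \<open>Measure for the induction that rounds a point: it drops whenever a move makes a further
  rank or nonnegativity constraint tight without loosening a tight one.\<close>

definition slack :: "(nat \<Rightarrow> real) \<Rightarrow> nat" where
  "slack x = card {A. A \<subseteq> E \<and> sum x A < r A} + card {l. l < n \<and> 0 < x l}"

text \<open>Move in the direction \<open>e_i - e_j\<close> until the first constraint becomes tight.
  No tight set separates \<open>i\<close> from \<open>j\<close>, so the step is positive and every
  tight constraint stays tight.\<close>

lemma rank_polytope_move: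
  assumes x: "x \<in> rank_polytope" and ij: "i < n" "j < n" "i \<noteq> j" "0 < x i" "0 < x j"
    and tight: "\<And>A. A \<subseteq> E \<Longrightarrow> sum x A = r A \<Longrightarrow> i \<in> A \<longleftrightarrow> j \<in> A"
  obtains \<alpha> where "\<alpha> > 0"
    "(\<lambda>l. x l + (if l = i then \<alpha> else 0) - (if l = j then \<alpha> else 0)) \<in> rank_polytope"
    "slack (\<lambda>l. x l + (if l = i then \<alpha> else 0) - (if l = j then \<alpha> else 0)) < slack x"
proof -
  define S where "S = {A. A \<subseteq> E \<and> i \<in> A \<and> j \<notin> A}"
  \<comment> \<open>The step lengths at which \<open>x j\<close> reaches 0 or a set containing
    \<open>i\<close> but not \<open>j\<close> becomes tight.\<close>
  define C where "C = insert (x j) ((\<lambda>A. r A - sum x A) ` S)"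
  define \<alpha> where "\<alpha> = Min C"
  define y where "y = (\<lambda>l. x l + (if l = i then \<alpha> else 0) - (if l = j then \<alpha> else 0))"
  have finS: "finite S" unfolding S_def by simp
  have finC: "finite C" and neC: "C \<noteq> {}" unfolding C_def using finS by auto
  have le: "sum x A \<le> r A" if "A \<subseteq> E" for A using x that by (auto simp: rank_polytope_def)
  have "0 < c" if "c \<in> C" for c
  proof -
    have "0 < r A - sum x A" if "A \<in> S" for A
      using that le[of A] tight[of A] unfolding S_def by fastforce
    thus ?thesis using that ij unfolding C_def by auto
  qed
  hence pos: "0 < \<alpha>" using finC neC unfolding \<alpha>_def by simp
  have \<alpha>C: "\<alpha> \<in> C" unfolding \<alpha>_def using finC neC by (rule Min_in)
  have \<alpha>le: "\<alpha> \<le> x j" "\<And>A. A \<in> S \<Longrightarrow> \<alpha> \<le> r A - sum x A"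
    unfolding \<alpha>_def using finC by (auto simp: C_def)
  have sumy: "sum y A = sum x A + (if i \<in> A then \<alpha> else 0) - (if j \<in> A then \<alpha> else 0)" if "A \<subseteq> E" for A
  proof -
    have "finite A" using that finite_subset by blast
    thus ?thesis unfolding y_def by (simp add: sum.distrib sum_subtractf)
  qed
  have leyA: "sum y A \<le> r A" if A: "A \<subseteq> E" for A
  proof (cases "A \<in> S")
    case True
    thus ?thesis using \<alpha>le(2)[OF True] sumy[OF A] unfolding S_def by simp
  next
    case False
    thus ?thesis using le[OF A] sumy[OF A] pos A unfolding S_def by auto
  qed
  have y: "y \<in> rank_polytope"
    unfolding rank_polytope_def
  proof (intro CollectI conjI allI impI)
    fix l show "0 \<le> y l" using x pos \<alpha>le(1) ij unfolding y_def rank_polytope_def by auto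
  next
    fix l assume "n \<le> l" thus "y l = 0" using x ij unfolding y_def rank_polytope_def by auto
  next
    fix A assume "A \<subseteq> E" thus "sum y A \<le> r A" by (rule leyA)
  next
    show "sum y E = k" using sumy[of E] ij x unfolding rank_polytope_def by simp
  qed
  let ?N = "\<lambda>x :: nat \<Rightarrow> real. {A. A \<subseteq> E \<and> sum x A < r A}" and ?P = "\<lambda>x :: nat \<Rightarrow> real. {l. l < n \<and> 0 < x l}"
  have N: "?N y \<subseteq> ?N x"
  proof
    fix A assume "A \<in> ?N y"
    hence A: "A \<subseteq> E" "sum y A < r A" by auto
    have "sum x A \<noteq> r A" using tight[OF A(1)] A(2) sumy[OF A(1)] by auto
    thus "A \<in> ?N x" using le[OF A(1)] A(1) by simp
  qed
  have P: "?P y \<subseteq> ?P x" using ij pos unfolding y_def by (auto split: if_splits)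
  have "?N y \<subset> ?N x \<or> ?P y \<subset> ?P x"
  proof (cases "\<alpha> = x j")
    case True
    hence "j \<in> ?P x - ?P y" using ij unfolding y_def by auto
    thus ?thesis using P by blast
  next
    case False
    then obtain A where A: "A \<in> S" "\<alpha> = r A - sum x A" using \<alpha>C unfolding C_def by auto
    hence "A \<in> ?N x - ?N y" using sumy[of A] pos unfolding S_def by auto
    thus ?thesis using N by blast
  qed
  hence "card (?N y) < card (?N x) \<or> card (?P y) < card (?P x)"
    using psubset_card_mono[of "?N x" "?N y"] psubset_card_mono[of "?P x" "?P y"] by auto
  moreover have "card (?N y) \<le> card (?N x)" using N by (intro card_mono) auto
  moreover have "card (?P y) \<le> card (?P x)" using P by (intro card_mono) auto
  ultimately have "slack y < slack x" unfolding slack_def by linarith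
  thus ?thesis using that[OF pos] y unfolding y_def by blast
qed

lemma indicator_in_base_polytope: "b \<in> B \<Longrightarrow> indicator b \<in> base_polytope B"
  unfolding base_polytope_def using finite_bases
  by (intro CollectI exI[of _ "\<lambda>c. if c = b then 1 else 0"]) (auto simp: if_distrib[of "\<lambda>x. x * _"] cong: if_cong)

text \<open>Such an \<open>x\<close> is the indicator of a set \<open>S\<close> of size
  \<open>k\<close> and rank at least \<open>k\<close>; a basis attaining that rank contains
  \<open>S\<close>, hence equals it.\<close>

lemma integral_rank_polytope:
  assumes x: "x \<in> rank_polytope" and int: "\<And>l. l < n \<Longrightarrow> x l = 0 \<or> x l = 1"
  shows "x \<in> base_polytope B"
proof -
  define S where "S = {l. l < n \<and> x l = 1}"
  have S: "S \<subseteq> E" "finite S" unfolding S_def by auto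
  have xS: "x = indicator S"
  proof
    fix l show "x l = indicator S l"
      using int[of l] x unfolding S_def rank_polytope_def by (cases "l < n") (auto simp: Int_insert_right)
  qed
  have "sum x E = card S" "sum x S = card S"
    using S xS by (simp_all add: sum_indicator_card Int_absorb1 Int_absorb2)
  hence k: "card S = k" and "card S \<le> r S" using x S unfolding rank_polytope_def by auto
  obtain b where b: "b \<in> B" "card (b \<inter> S) = r S" by (rule mrank_attained)
  have "b \<inter> S = S" using b S \<open>card S \<le> r S\<close> by (intro card_seteq) auto
  moreover have "b \<inter> S = b"
    using b k \<open>card S \<le> r S\<close> card_basis finite_basis by (intro card_seteq) auto
  ultimately show ?thesis using indicator_in_base_polytope b(1) xS by simp
qed

text \<open>Uncrossing: \<open>x\<close> is modular while the rank is submodular, so neither the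
  union nor the intersection can have slack.\<close>

lemma tight_Int:
  assumes x: "x \<in> rank_polytope" and A: "A \<subseteq> E" "sum x A = r A" and C: "C \<subseteq> E" "sum x C = r C"
  shows "sum x (A \<inter> C) = r (A \<inter> C)"
proof -
  have "finite A" "finite C" using A C finite_subset by blast+
  hence "sum x (A \<union> C) + sum x (A \<inter> C) = sum x A + sum x C" by (rule sum.union_inter)
  moreover have "sum x (A \<union> C) \<le> r (A \<union> C)" "sum x (A \<inter> C) \<le> r (A \<inter> C)"
    using A C by (auto intro!: rank_polytope_le[OF x])
  moreover have "real (r (A \<union> C)) + r (A \<inter> C) \<le> r A + r C" using mrank_submodular[of A C] by linarith
  ultimately show ?thesis using A C by linarith
qed

text \<open>A non-integral point is moved in both directions \<open>e\<^sub>i - e\<^sub>j\<close> and \<open>e\<^sub>j - e\<^sub>i\<close>, where \<open>i\<close> and \<open>j\<close>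
  are fractional coordinates in a minimal tight set that has any: no tight set separates them.\<close>
lemma rank_polytope_subset: "x \<in> rank_polytope \<Longrightarrow> x \<in> base_polytope B"
proof (induction "slack x" arbitrary: x rule: less_induct)
  case less
  note x = less.prems
  show ?case
  proof (cases "\<forall>l<n. x l = 0 \<or> x l = 1")
    case True
    thus ?thesis using integral_rank_polytope x by blast
  next
    case False
    define F where "F = {l. l < n \<and> 0 < x l \<and> x l < 1}"
    have x01: "0 \<le> x l \<and> x l \<le> 1" for l
      using x rank_polytope_le_1 unfolding rank_polytope_def by auto
    let ?T = "\<lambda>A. A \<subseteq> E \<and> sum x A = r A \<and> A \<inter> F \<noteq> {}"
    obtain l0 where "l0 < n" "x l0 \<noteq> 0" "x l0 \<noteq> 1" using False by blast
    hence "l0 \<in> E \<inter> F" using x01[of l0] unfolding F_def by auto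
    hence "?T E" using x mrank_ground unfolding rank_polytope_def by auto
    then obtain T where T: "?T T" and min: "\<And>A. ?T A \<Longrightarrow> card T \<le> card A"
      using ex_has_least_nat[of ?T E card] by blast
    have finT: "finite T" using T finite_subset by blast
    obtain i where i: "i \<in> T" "i \<in> F" using T by blast
    \<comment> \<open>A lone fractional coordinate in \<open>T\<close> would be the integer
      \<open>r T\<close> minus a sum of integers.\<close>
    have "\<exists>j\<in>T. j \<in> F \<and> j \<noteq> i"
    proof (rule ccontr)
      assume no: "\<not> ?thesis"
      have "x l \<in> \<int>" if l: "l \<in> T - {i}" for l
      proof -
        have "l < n" "l \<notin> F" using l no T by auto
        hence "x l = 0 \<or> x l = 1" using x01[of l] unfolding F_def by auto
        thus ?thesis by auto
      qed
      hence "sum x (T - {i}) \<in> \<int>" by (intro Ints_sum) auto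
      moreover have "x i = real (r T) - sum x (T - {i})"
        using T finT i sum.remove[of T i x] by simp
      ultimately have "x i \<in> \<int>" by simp
      then obtain z :: int where "x i = z" by (elim Ints_cases)
      thus False using i unfolding F_def by auto
    qed
    then obtain j where j: "j \<in> T" "j \<in> F" "j \<noteq> i" by blast
    \<comment> \<open>Intersecting with \<open>T\<close> gives a tight set that still has a
      fractional coordinate, so minimality forces \<open>T\<close> inside \<open>A\<close>.\<close>
    have sub: "T \<subseteq> A" if "A \<subseteq> E" "sum x A = r A" "A \<inter> T \<inter> F \<noteq> {}" for A
    proof -
      have "?T (A \<inter> T)" using tight_Int[OF x that(1,2)] T that(3) by auto
      hence "card T \<le> card (A \<inter> T)" by (rule min)
      hence "A \<inter> T = T" using finT by (intro card_seteq) auto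
      thus ?thesis by blast
    qed
    have tight: "i \<in> A \<longleftrightarrow> j \<in> A" if "A \<subseteq> E" "sum x A = r A" for A
      using sub[OF that] i j by blast
    have ij: "i < n" "j < n" "0 < x i" "0 < x j" using i j unfolding F_def by auto
    obtain \<alpha> where \<alpha>: "\<alpha> > 0"
      "(\<lambda>l. x l + (if l = i then \<alpha> else 0) - (if l = j then \<alpha> else 0)) \<in> rank_polytope"
      "slack (\<lambda>l. x l + (if l = i then \<alpha> else 0) - (if l = j then \<alpha> else 0)) < slack x"
      by (rule rank_polytope_move[OF x ij(1,2) j(3)[symmetric] ij(3,4) tight])
    obtain \<beta> where \<beta>: "\<beta> > 0"
      "(\<lambda>l. x l + (if l = j then \<beta> else 0) - (if l = i then \<beta> else 0)) \<in> rank_polytope"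
      "slack (\<lambda>l. x l + (if l = j then \<beta> else 0) - (if l = i then \<beta> else 0)) < slack x"
      by (rule rank_polytope_move[OF x ij(2,1) j(3) ij(4,3) tight[symmetric]])
    \<comment> \<open>With these weights the two opposite displacements cancel, so the convex
      combination is \<open>x\<close> itself.\<close>
    have one: "\<beta> / (\<alpha> + \<beta>) + \<alpha> / (\<alpha> + \<beta>) = 1"
      using \<alpha>(1) \<beta>(1) by (simp add: add.commute flip: add_divide_distrib)
    hence "(\<lambda>l. \<beta> / (\<alpha> + \<beta>) * (x l + (if l = i then \<alpha> else 0) - (if l = j then \<alpha> else 0)) +
       \<alpha> / (\<alpha> + \<beta>) * (x l + (if l = j then \<beta> else 0) - (if l = i then \<beta> else 0))) \<in> base_polytope B"
      using less.hyps[OF \<alpha>(3,2)] less.hyps[OF \<beta>(3,2)] \<alpha>(1) \<beta>(1)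
      by (intro base_polytope_convex) auto
    also have "(\<lambda>l. \<beta> / (\<alpha> + \<beta>) * (x l + (if l = i then \<alpha> else 0) - (if l = j then \<alpha> else 0)) +
       \<alpha> / (\<alpha> + \<beta>) * (x l + (if l = j then \<beta> else 0) - (if l = i then \<beta> else 0))) = x" (is "?y = x")
    proof
      fix l
      define d :: real where "d = (if l = i then 1 else 0) - (if l = j then 1 else 0)"
      have "?y l = \<beta> / (\<alpha> + \<beta>) * (x l + \<alpha> * d) + \<alpha> / (\<alpha> + \<beta>) * (x l - \<beta> * d)"
        unfolding d_def by simp
      also have "\<dots> = (\<beta> / (\<alpha> + \<beta>) + \<alpha> / (\<alpha> + \<beta>)) * x l"
        by (simp add: algebra_simps)
      finally show "?y l = x l" using one by simp
    qed
    finally show ?thesis .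
  qed
qed

lemma base_polytope_eq: "base_polytope B = rank_polytope"
  using base_polytope_subset rank_polytope_subset by blast

end

section \<open>The Euler characteristic as a valuation\<close>

text \<open>Group the non-empty intervals by right endpoint \<open>b\<close>. Subtracting the
  vanishing sum just to the right of \<open>b\<close> from the one at \<open>b\<close> leaves
  exactly the coefficients of the intervals ending at \<open>b\<close>, so each group sums to
  zero.\<close>

lemma sum_interval_indicator_zero:
  fixes a :: "'i \<Rightarrow> real" and I :: "'i \<Rightarrow> real set"
  assumes J: "finite J" and I: "\<And>j. j \<in> J \<Longrightarrow> compact (I j) \<and> connected (I j)"
    and zero: "\<And>t. (\<Sum>j\<in>J. a j * indicator (I j) t) = 0"
  shows "(\<Sum>j\<in>J. a j * of_bool (I j \<noteq> {})) = 0"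
proof -
  define K where "K = {j \<in> J. I j \<noteq> {}}"
  have finK: "finite K" using J unfolding K_def by simp
  have "\<forall>j\<in>K. \<exists>p. fst p \<le> snd p \<and> I j = {fst p..snd p}"
  proof
    fix j assume "j \<in> K"
    hence "compact (I j)" "connected (I j)" and ne: "I j \<noteq> {}" using I unfolding K_def by auto
    then obtain c d where "I j = {c..d}" using connected_compact_interval_1 by metis
    thus "\<exists>p. fst p \<le> snd p \<and> I j = {fst p..snd p}" using ne by (intro exI[of _ "(c, d)"]) auto
  qed
  then obtain p where p: "\<And>j. j \<in> K \<Longrightarrow> fst (p j) \<le> snd (p j) \<and> I j = {fst (p j)..snd (p j)}"
    by metis
  define L R where "L = fst \<circ> p" and "R = snd \<circ> p"
  have LR: "L j \<le> R j" "I j = {L j..R j}" if "j \<in> K" for j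
    using p[OF that] unfolding L_def R_def by auto
  have zeroK: "(\<Sum>j\<in>K. a j * indicator (I j) t) = 0" for t
  proof -
    have "(\<Sum>j\<in>K. a j * indicator (I j) t) = (\<Sum>j\<in>J. a j * indicator (I j) t)"
      using J unfolding K_def by (intro sum.mono_neutral_left) auto
    thus ?thesis using zero by simp
  qed
  have fibre: "(\<Sum>j\<in>{j\<in>K. R j = b}. a j) = 0" for b
  proof -
    \<comment> \<open>Since there are finitely many endpoints, some \<open>c\<close> lies beyond
      \<open>b\<close> but before every later endpoint.\<close>
    have "\<forall>\<^sub>F c in at_right b. \<forall>j\<in>K. (b < L j \<longrightarrow> c < L j) \<and> (b < R j \<longrightarrow> c < R j)"
    proof (rule eventually_ball_finite[OF finK], intro ballI eventually_conj)
      fix j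
      have "\<forall>\<^sub>F c in at_right b. b < y \<longrightarrow> c < y" for y :: real
        by (cases "b < y") (auto simp: eventually_at_right_field)
      thus "\<forall>\<^sub>F c in at_right b. b < L j \<longrightarrow> c < L j" "\<forall>\<^sub>F c in at_right b. b < R j \<longrightarrow> c < R j" by auto
    qed
    moreover have "\<forall>\<^sub>F c in at_right b. b < c" by (rule eventually_at_right_less)
    ultimately have "\<forall>\<^sub>F c in at_right b. b < c \<and> (\<forall>j\<in>K. (b < L j \<longrightarrow> c < L j) \<and> (b < R j \<longrightarrow> c < R j))"
      by eventually_elim simp
    then obtain c where c: "b < c" "\<And>j. j \<in> K \<Longrightarrow> b < L j \<Longrightarrow> c < L j" "\<And>j. j \<in> K \<Longrightarrow> b < R j \<Longrightarrow> c < R j"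
      using eventually_happens'[OF trivial_limit_at_right_real] by blast
    have "(\<Sum>j\<in>{j\<in>K. R j = b}. a j) = (\<Sum>j\<in>K. a j * of_bool (R j = b))"
      using finK by (simp add: sum.inter_filter of_bool_def if_distrib[of "\<lambda>x. _ * x"] cong: if_cong)
    also have "\<dots> = (\<Sum>j\<in>K. a j * indicator (I j) b - a j * indicator (I j) c)"
    proof (rule sum.cong)
      fix j assume j: "j \<in> K"
      have "indicat_real (I j) b - indicat_real (I j) c = of_bool (R j = b)"
      proof -
        have "L j \<le> b \<or> c < L j" "R j \<le> b \<or> c < R j" using c(2,3)[OF j] by force+
        thus ?thesis using LR[OF j] c(1) by (auto simp: indicator_def)
      qed
      thus "a j * of_bool (R j = b) = a j * indicator (I j) b - a j * indicator (I j) c"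
        by (simp flip: right_diff_distrib)
    qed simp
    also have "\<dots> = 0" using zeroK by (simp add: sum_subtractf)
    finally show ?thesis .
  qed
  have "(\<Sum>j\<in>J. a j * of_bool (I j \<noteq> {})) = sum a K"
    using J unfolding K_def
    by (simp add: sum.inter_filter of_bool_def if_distrib[of "\<lambda>x. _ * x"] cong: if_cong)
  also have "\<dots> = (\<Sum>b\<in>R ` K. \<Sum>j\<in>{j\<in>K. R j = b}. a j)"
    using finK by (rule sum.image_gen)
  also have "\<dots> = 0" using fibre by simp
  finally show ?thesis .
qed

definition fun_convex :: "(nat \<Rightarrow> real) set \<Rightarrow> bool" where
  "fun_convex P \<longleftrightarrow> (\<forall>x\<in>P. \<forall>y\<in>P. \<forall>u v. 0 \<le> u \<longrightarrow> 0 \<le> v \<longrightarrow> u + v = 1 \<longrightarrow> (\<lambda>i. u * x i + v * y i) \<in> P)"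

lemma continuous_on_fun_upd [continuous_intros]:
  fixes x :: "nat \<Rightarrow> 'b::topological_space"
  shows "continuous_on S (\<lambda>t. x(i := t))"
proof (rule continuous_on_coordinatewise_then_product)
  fix j show "continuous_on S (\<lambda>t. (x(i := t)) j)" by (cases "j = i") auto
qed

lemma continuous_on_coordinate: "continuous_on S (\<lambda>x. x i)"
  by (rule continuous_on_subset[OF continuous_on_product_coordinates]) simp

text \<open>The slice is closed as a preimage, and it lies in the compact projection of
  \<open>P\<close> to coordinate \<open>i\<close>.\<close>

lemma compact_slice:
  fixes P :: "(nat \<Rightarrow> real) set"
  assumes "compact P"
  shows "compact {t. x(i := t) \<in> P}"
proof -
  have "closed ((\<lambda>t. x(i := t)) -` P)"
    using compact_imp_closed[OF assms] by (intro closed_vimage continuous_on_fun_upd)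
  moreover have "compact ((\<lambda>z. z i) ` P)"
    using assms by (intro compact_continuous_image continuous_on_coordinate)
  moreover have "{t. x(i := t) \<in> P} = ((\<lambda>z. z i) ` P) \<inter> ((\<lambda>t. x(i := t)) -` P)"
  proof -
    have "t \<in> (\<lambda>z. z i) ` P" if "x(i := t) \<in> P" for t using imageI[OF that, of "\<lambda>z. z i"] by simp
    thus ?thesis by auto
  qed
  ultimately show ?thesis by (simp add: compact_Int_closed)
qed

lemma connected_slice:
  assumes "fun_convex P"
  shows "connected {t. x(i := t) \<in> P}"
proof -
  have "convex {t. x(i := t) \<in> P}"
  proof (rule convexI)
    fix s t u v :: real
    assume st: "s \<in> {t. x(i := t) \<in> P}" "t \<in> {t. x(i := t) \<in> P}" and uv: "0 \<le> u" "0 \<le> v" "u + v = 1"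
    have "(\<lambda>j. u * (x(i := s)) j + v * (x(i := t)) j) \<in> P"
      using assms st uv unfolding fun_convex_def by blast
    moreover have "(\<lambda>j. u * (x(i := s)) j + v * (x(i := t)) j) = x(i := u * s + v * t)"
      using uv by (auto simp: fun_eq_iff simp flip: distrib_right)
    ultimately show "u *\<^sub>R s + v *\<^sub>R t \<in> {t. x(i := t) \<in> P}" by (metis mem_Collect_eq real_scaleR_def)
  qed
  thus ?thesis by (rule convex_connected)
qed

text \<open>The Euler characteristic is a valuation; it is computed by integrating out
  one coordinate at a time.\<close>
lemma sum_convex_indicator_zero:
  fixes a :: "'i \<Rightarrow> real" and P :: "'i \<Rightarrow> (nat \<Rightarrow> real) set"
  assumes J: "finite J" and P: "\<And>j. j \<in> J \<Longrightarrow> compact (P j) \<and> fun_convex (P j)"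
    and supp: "\<And>j x i. j \<in> J \<Longrightarrow> x \<in> P j \<Longrightarrow> n \<le> i \<Longrightarrow> x i = 0"
    and zero: "\<And>x. (\<Sum>j\<in>J. a j * indicator (P j) x) = 0"
  shows "(\<Sum>j\<in>J. a j * of_bool (P j \<noteq> {})) = 0"
  using P supp zero
proof (induction n arbitrary: P)
  case 0
  have "indicator (P j) (\<lambda>_. 0) = (of_bool (P j \<noteq> {}) :: real)" if "j \<in> J" for j
  proof -
    have "x = (\<lambda>_. 0)" if "x \<in> P j" for x using 0(2)[OF \<open>j \<in> J\<close> that] by auto
    thus ?thesis by (auto simp: indicator_def)
  qed
  hence "(\<Sum>j\<in>J. a j * of_bool (P j \<noteq> {})) = (\<Sum>j\<in>J. a j * indicator (P j) (\<lambda>_. 0))"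
    by (intro sum.cong) auto
  thus ?case using 0(3) by simp
next
  case (Suc n)
  \<comment> \<open>The shadow of \<open>P j\<close> along the last coordinate; it is non-empty
    exactly if \<open>P j\<close> is.\<close>
  define Q where "Q = (\<lambda>j. (\<lambda>x. x(n := 0)) ` P j)"
  have "(\<Sum>j\<in>J. a j * of_bool (Q j \<noteq> {})) = 0"
  proof (rule Suc.IH)
    fix j assume j: "j \<in> J"
    have "continuous_on (P j) (\<lambda>x. x(n := 0))"
    proof (rule continuous_on_coordinatewise_then_product)
      fix i show "continuous_on (P j) (\<lambda>x. (x(n := 0)) i)"
        by (cases "i = n") (auto intro: continuous_on_coordinate)
    qed
    hence "compact (Q j)" unfolding Q_def using Suc.prems(1)[OF j] by (intro compact_continuous_image) auto
    moreover have "fun_convex (Q j)"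
      unfolding fun_convex_def
    proof (intro ballI allI impI)
      fix x y u v assume "x \<in> Q j" "y \<in> Q j" and uv: "0 \<le> u" "0 \<le> v" "u + v = (1::real)"
      then obtain x' y' where xy: "x' \<in> P j" "y' \<in> P j" "x = x'(n := 0)" "y = y'(n := 0)"
        unfolding Q_def by blast
      have "(\<lambda>i. u * x' i + v * y' i) \<in> P j"
        using Suc.prems(1)[OF j] xy uv unfolding fun_convex_def by blast
      moreover have "(\<lambda>i. u * x i + v * y i) = (\<lambda>i. u * x' i + v * y' i)(n := 0)"
        using xy by auto
      ultimately show "(\<lambda>i. u * x i + v * y i) \<in> Q j" unfolding Q_def by blast
    qed
    ultimately show "compact (Q j) \<and> fun_convex (Q j)" ..
  next
    fix j x i assume "j \<in> J" "x \<in> Q j" "n \<le> i"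
    thus "x i = 0" using Suc.prems(2)[of j _ i] unfolding Q_def by (cases "i = n") auto
  next
    fix x :: "nat \<Rightarrow> real"
    show "(\<Sum>j\<in>J. a j * indicator (Q j) x) = 0"
    proof (cases "x n = 0")
      case True
      \<comment> \<open>The fibre of \<open>P j\<close> over \<open>x\<close> is a possibly empty
        compact interval, and it is non-empty exactly if \<open>x\<close> lies in the shadow. The
        one-dimensional case therefore yields the relation among the shadows.\<close>
      have "indicator (Q j) x = (of_bool ({t. x(n := t) \<in> P j} \<noteq> {}) :: real)" for j
      proof -
        have "x \<in> Q j \<longleftrightarrow> (\<exists>t. x(n := t) \<in> P j)"
        proof
          assume "x \<in> Q j"
          then obtain y where "y \<in> P j" "x = y(n := 0)" unfolding Q_def by blast
          hence "x(n := y n) \<in> P j" by simp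
          thus "\<exists>t. x(n := t) \<in> P j" ..
        next
          assume "\<exists>t. x(n := t) \<in> P j"
          then obtain t where "x(n := t) \<in> P j" ..
          moreover have "x = (x(n := t))(n := 0)" using True by auto
          ultimately show "x \<in> Q j" unfolding Q_def by blast
        qed
        thus ?thesis by (simp add: indicator_def)
      qed
      hence "(\<Sum>j\<in>J. a j * indicator (Q j) x) = (\<Sum>j\<in>J. a j * of_bool ({t. x(n := t) \<in> P j} \<noteq> {}))" by simp
      also have "\<dots> = 0"
      proof (rule sum_interval_indicator_zero[OF J])
        fix j assume "j \<in> J"
        thus "compact {t. x(n := t) \<in> P j} \<and> connected {t. x(n := t) \<in> P j}"
          using Suc.prems(1) compact_slice connected_slice by blast
      next
        fix t
        have "indicator {t. x(n := t) \<in> P j} t = (indicator (P j) (x(n := t)) :: real)" for j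
          by (simp only: indicator_def mem_Collect_eq)
        thus "(\<Sum>j\<in>J. a j * indicator {t. x(n := t) \<in> P j} t) = 0"
          using Suc.prems(3)[of "x(n := t)"] by (simp only:)
      qed
      finally show ?thesis .
    next
      case False
      hence "x \<notin> Q j" for j unfolding Q_def by auto
      thus ?thesis by simp
    qed
  qed
  moreover have "Q j \<noteq> {} \<longleftrightarrow> P j \<noteq> {}" for j unfolding Q_def by simp
  ultimately show ?case by simp
qed

text \<open>Tychonoff's theorem for a product of unit intervals.\<close>

lemma compact_unit_cube: "compact {x :: nat \<Rightarrow> real. \<forall>i. 0 \<le> x i \<and> x i \<le> 1}"
proof -
  have "compactin (product_topology (\<lambda>i :: nat. euclideanreal) UNIV) (PiE UNIV (\<lambda>i. {0..1}))"
    by (subst compactin_PiE) auto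
  also have "PiE UNIV (\<lambda>i :: nat. {0..1::real}) = {x. \<forall>i. 0 \<le> x i \<and> x i \<le> 1}" by auto
  finally show ?thesis by (simp add: euclidean_product_topology)
qed

context matroid_on
begin

text \<open>The inequality description exhibits the polytope as a closed subset of the compact unit
  cube.\<close>

lemma compact_base_polytope: "compact (base_polytope B)"
proof -
  let ?C = "{x :: nat \<Rightarrow> real. \<forall>i. 0 \<le> x i \<and> x i \<le> 1}"
  have sum_cont: "continuous_on UNIV (\<lambda>x :: nat \<Rightarrow> real. sum x A)" for A
    by (intro continuous_on_sum continuous_on_product_coordinates)
  have "rank_polytope \<subseteq> ?C" using rank_polytope_le_1 unfolding rank_polytope_def by auto
  moreover have "closed rank_polytope"
    unfolding rank_polytope_def Collect_conj_eq Collect_all_eq imp_conv_disj Collect_disj_eq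
    by (intro closed_Int closed_INT ballI closed_Un closed_Collect_le closed_Collect_eq sum_cont
        continuous_on_product_coordinates continuous_on_const closed_Collect_const)
  ultimately have "rank_polytope = ?C \<inter> rank_polytope" "compact (?C \<inter> rank_polytope)"
    using compact_Int_closed[OF compact_unit_cube] by auto
  thus ?thesis using base_polytope_eq by simp
qed

end

section \<open>The Tutte polynomial is a valuative invariant\<close>

lemma zsmul_plus_1: "zsmul (a + 1) v = zsmul a v + v"
proof (cases "0 \<le> a")
  case True
  hence "nat (a + 1) = Suc (nat a)" by simp
  thus ?thesis using True by (simp add: zsmul_def)
next
  case False
  hence "nat (- a) = Suc (nat (- (a + 1)))" by simp
  thus ?thesis using False by (auto simp: zsmul_def)
qed

lemma zsmul_0 [simp]: "zsmul 0 v = 0"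
  by (simp add: zsmul_def)

lemma zsmul_1 [simp]: "zsmul 1 v = v"
  by (simp add: zsmul_def)

lemma zsmul_minus_1 [simp]: "zsmul (- 1) v = - v"
  by (simp add: zsmul_def)

lemma zsmul_add_left: "zsmul (a + b) v = zsmul a v + zsmul b v"
proof (induction b rule: int_induct[where k = 0])
  case (step1 i)
  thus ?case using zsmul_plus_1[of "a + i" v] zsmul_plus_1[of i v] by (simp add: algebra_simps)
next
  case (step2 i)
  thus ?case using zsmul_plus_1[of "a + (i - 1)" v] zsmul_plus_1[of "i - 1" v] by (simp add: algebra_simps)
qed simp

lemma zsmul_sum_left: "zsmul (sum c A) v = (\<Sum>i\<in>A. zsmul (c i) v)"
  by (induction A rule: infinite_finite_induct) (auto simp: zsmul_add_left)

lemma zsmul_eq_mult: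
  fixes v :: "'a :: ring_1"
  shows "zsmul a v = of_int a * v"
proof (cases "0 \<le> a")
  case False
  hence "of_nat (nat (- a)) = (- of_int a :: 'a)" by (simp add: of_nat_nat)
  thus ?thesis using False by (simp add: zsmul_def)
qed (simp add: zsmul_def of_nat_nat)

section \<open>Valuativity of functions of the rank of a fixed set\<close>

lemma sum_list_pairs: "(\<Sum>(a, b)\<leftarrow>ms. g a b) = (\<Sum>j<length ms. g (fst (ms ! j)) (snd (ms ! j)))"
  by (simp add: sum_list_sum_nth split_beta atLeast0LessThan)

text \<open>Truncating every polytope by the half-space \<open>m \<le> sum x A\<close> multiplies
  the indicator relation by a common factor, so it persists. A truncation is non-empty exactly if
  the rank of \<open>A\<close> reaches \<open>m\<close>, where a basis attaining the rank supplies a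
  point. The Euler characteristic then gives the claim.\<close>

lemma sum_rank_threshold_zero:
  assumes J: "finite J" and M: "\<And>j. j \<in> J \<Longrightarrow> M j \<in> matroids n k" and A: "A \<subseteq> {0..<n}"
    and zero: "\<And>x. \<forall>i\<ge>n. x i = 0 \<Longrightarrow> (\<Sum>j\<in>J. real_of_int (a j) * indicator (base_polytope (M j)) x) = 0"
  shows "(\<Sum>j\<in>J. a j * of_bool (m \<le> mrank (M j) A)) = 0"
proof -
  define P where "P = (\<lambda>j. base_polytope (M j) \<inter> {x. real m \<le> sum x A})"
  have finA: "finite A" using A finite_subset by blast
  have loc: "matroid_on n k (M j)" if "j \<in> J" for j using M[OF that] by unfold_locales
  have "(\<Sum>j\<in>J. real_of_int (a j) * of_bool (P j \<noteq> {})) = 0"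
  proof (rule sum_convex_indicator_zero[OF J, where n = n])
    fix j assume j: "j \<in> J"
    interpret matroid_on n k "M j" by (rule loc[OF j])
    have "closed {x :: nat \<Rightarrow> real. real m \<le> sum x A}"
      by (intro closed_Collect_le continuous_on_const continuous_on_sum continuous_on_coordinate)
    hence "compact (P j)" unfolding P_def by (intro compact_Int_closed compact_base_polytope)
    moreover have "fun_convex (P j)"
      unfolding fun_convex_def
    proof (intro ballI allI impI)
      fix x y u v assume xy: "x \<in> P j" "y \<in> P j" and uv: "0 \<le> u" "0 \<le> v" "u + v = (1::real)"
      have "real m = u * m + v * m" using uv by (simp flip: distrib_right)
      also have "\<dots> \<le> u * sum x A + v * sum y A"
        using xy uv unfolding P_def by (intro add_mono mult_left_mono) auto
      also have "\<dots> = (\<Sum>i\<in>A. u * x i + v * y i)" by (simp add: sum.distrib sum_distrib_left)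
      finally show "(\<lambda>i. u * x i + v * y i) \<in> P j"
        using xy uv base_polytope_convex unfolding P_def by blast
    qed
    ultimately show "compact (P j) \<and> fun_convex (P j)" ..
    show "x i = 0" if "x \<in> P j" "n \<le> i" for x i
      using that base_polytope_eq unfolding P_def rank_polytope_def by auto
  next
    fix x :: "nat \<Rightarrow> real"
    have "(\<Sum>j\<in>J. real_of_int (a j) * indicator (base_polytope (M j)) x) = 0"
    proof (cases "\<forall>i\<ge>n. x i = 0")
      case False
      have "x \<notin> base_polytope (M j)" if "j \<in> J" for j
      proof -
        interpret matroid_on n k "M j" by (rule loc[OF that])
        show ?thesis using False base_polytope_eq unfolding rank_polytope_def by auto
      qed
      thus ?thesis by (intro sum.neutral) auto
    qed (rule zero)
    hence "(\<Sum>j\<in>J. real_of_int (a j) * indicator (base_polytope (M j)) x) * of_bool (m \<le> sum x A) = 0" by simp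
    thus "(\<Sum>j\<in>J. real_of_int (a j) * indicator (P j) x) = 0"
      unfolding sum_distrib_right P_def by (simp add: indicator_def mult.assoc of_bool_conj)
  qed
  moreover have "P j \<noteq> {} \<longleftrightarrow> m \<le> mrank (M j) A" if j: "j \<in> J" for j
  proof -
    interpret matroid_on n k "M j" by (rule loc[OF j])
    show ?thesis
    proof
      assume "P j \<noteq> {}"
      then obtain x where "x \<in> rank_polytope" "real m \<le> sum x A"
        unfolding P_def base_polytope_eq by blast
      thus "m \<le> mrank (M j) A" using rank_polytope_le[OF _ A, of x] by linarith
    next
      assume m: "m \<le> mrank (M j) A"
      obtain b where b: "b \<in> M j" "card (b \<inter> A) = mrank (M j) A" by (rule mrank_attained)
      hence "indicator b \<in> P j"
        using m indicator_in_base_polytope finA unfolding P_def by (simp add: sum_indicator_card)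
      thus "P j \<noteq> {}" by blast
    qed
  qed
  ultimately have "(\<Sum>j\<in>J. real_of_int (a j) * of_bool (m \<le> mrank (M j) A)) = 0"
    by (simp cong: sum.cong)
  hence "real_of_int (\<Sum>j\<in>J. a j * of_bool (m \<le> mrank (M j) A)) = 0" by simp
  thus ?thesis by (simp only: of_int_eq_0_iff)
qed

text \<open>Any function of a rank is a combination of threshold events with its increments as
  coefficients; this extends \<open>sum_rank_threshold_zero\<close> to all functions of the
  rank.\<close>

lemma telescope_threshold:
  fixes \<phi> :: "nat \<Rightarrow> 'a :: ring_1"
  assumes "q \<le> k"
  shows "\<phi> q = \<phi> 0 + (\<Sum>m<k. of_bool (Suc m \<le> q) * (\<phi> (Suc m) - \<phi> m))"
proof -
  have "(\<Sum>m<k. of_bool (Suc m \<le> q) * (\<phi> (Suc m) - \<phi> m)) = (\<Sum>m<q. \<phi> (Suc m) - \<phi> m)"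
    using assms by (intro sum.mono_neutral_cong_right) auto
  also have "\<dots> = \<phi> q - \<phi> 0" by (rule sum_lessThan_telescope)
  finally show ?thesis by simp
qed

lemma sum_rank_function_zero:
  fixes \<phi> :: "nat \<Rightarrow> 'a :: comm_ring_1"
  assumes J: "finite J" and M: "\<And>j. j \<in> J \<Longrightarrow> M j \<in> matroids n k" and A: "A \<subseteq> {0..<n}"
    and zero: "\<And>x. \<forall>i\<ge>n. x i = 0 \<Longrightarrow> (\<Sum>j\<in>J. real_of_int (a j) * indicator (base_polytope (M j)) x) = 0"
  shows "(\<Sum>j\<in>J. of_int (a j) * \<phi> (mrank (M j) A)) = 0"
proof -
  have thr: "(\<Sum>j\<in>J. of_int (a j) * of_bool (m \<le> mrank (M j) A)) = (0 :: 'a)" for m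
  proof -
    have "(\<Sum>j\<in>J. of_int (a j) * of_bool (m \<le> mrank (M j) A)) =
        (of_int (\<Sum>j\<in>J. a j * of_bool (m \<le> mrank (M j) A)) :: 'a)" by simp
    thus ?thesis using sum_rank_threshold_zero[OF J M A zero] by simp
  qed
  have "(\<Sum>j\<in>J. of_int (a j) * \<phi> (mrank (M j) A)) =
      (\<Sum>j\<in>J. of_int (a j) * of_bool (0 \<le> mrank (M j) A) * \<phi> 0 +
        (\<Sum>m<k. of_int (a j) * of_bool (Suc m \<le> mrank (M j) A) * (\<phi> (Suc m) - \<phi> m)))"
  proof (rule sum.cong)
    fix j assume "j \<in> J"
    then interpret matroid_on n k "M j" using M by unfold_locales
    show "of_int (a j) * \<phi> (mrank (M j) A) = of_int (a j) * of_bool (0 \<le> mrank (M j) A) * \<phi> 0 +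
        (\<Sum>m<k. of_int (a j) * of_bool (Suc m \<le> mrank (M j) A) * (\<phi> (Suc m) - \<phi> m))"
      using arg_cong[OF telescope_threshold[OF mrank_le, of \<phi> A], of "\<lambda>z. of_int (a j) * z"]
      by (simp only: distrib_left sum_distrib_left mult.assoc) simp
  qed simp
  also have "\<dots> = (\<Sum>j\<in>J. of_int (a j) * of_bool (0 \<le> mrank (M j) A)) * \<phi> 0 +
      (\<Sum>m<k. (\<Sum>j\<in>J. of_int (a j) * of_bool (Suc m \<le> mrank (M j) A)) * (\<phi> (Suc m) - \<phi> m))"
    unfolding sum.distrib sum_distrib_right by (subst sum.swap[of _ J]) (rule refl)
  also have "\<dots> = 0" unfolding thr by simp
  finally show ?thesis .
qed

text \<open>All matroids involved have rank \<open>k\<close>, so for a fixed \<open>A\<close> the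
  Tutte summand depends on the matroid only through the rank of \<open>A\<close>.\<close>

lemma valuative_on_tutte: "valuative_on n k (tutte n)"
  unfolding valuative_on_def
proof (intro allI impI)
  fix ms :: "(int \<times> nat set set) list"
  assume ms: "\<forall>(a, B)\<in>set ms. B \<in> matroids n k"
    and zero: "\<forall>x :: nat \<Rightarrow> real. (\<forall>i\<ge>n. x i = 0) \<longrightarrow>
      (\<Sum>(a, B)\<leftarrow>ms. real_of_int a * indicator (base_polytope B) x) = 0"
  \<comment> \<open>Indexing by list positions keeps repeated entries as separate terms.\<close>
  define J a M where "J = {..<length ms}" and "a = (\<lambda>j. fst (ms ! j))" and "M = (\<lambda>j. snd (ms ! j))"
  have J: "finite J" by (simp add: J_def)
  have MJ: "M j \<in> matroids n k" if "j \<in> J" for j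
    using ms nth_mem[of j ms] that unfolding J_def M_def by fastforce
  have zeroJ: "(\<Sum>j\<in>J. real_of_int (a j) * indicator (base_polytope (M j)) x) = 0"
    if "\<forall>i\<ge>n. x i = 0" for x
    using zero that unfolding sum_list_pairs J_def a_def M_def by blast
  define \<phi> :: "nat set \<Rightarrow> nat \<Rightarrow> int poly poly"
    where "\<phi> = (\<lambda>A q. [: [:-1, 1:] ^ (k - q) :] * [: -1, 1 :] ^ (card A - q))"
  have "(\<Sum>(a, B)\<leftarrow>ms. zsmul a (tutte n B)) = (\<Sum>j\<in>J. of_int (a j) * tutte n (M j))"
    unfolding sum_list_pairs J_def a_def M_def by (simp add: zsmul_eq_mult)
  also have "\<dots> = (\<Sum>j\<in>J. \<Sum>A\<in>Pow {0..<n}. of_int (a j) * \<phi> A (mrank (M j) A))"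
  proof (rule sum.cong)
    fix j assume "j \<in> J"
    then interpret matroid_on n k "M j" using MJ by unfold_locales
    show "of_int (a j) * tutte n (M j) = (\<Sum>A\<in>Pow {0..<n}. of_int (a j) * \<phi> A (mrank (M j) A))"
      unfolding tutte_def mrank_ground \<phi>_def sum_distrib_left ..
  qed simp
  also have "\<dots> = (\<Sum>A\<in>Pow {0..<n}. \<Sum>j\<in>J. of_int (a j) * \<phi> A (mrank (M j) A))"
    by (rule sum.swap)
  also have "\<dots> = 0"
    using sum_rank_function_zero[OF J MJ _ zeroJ] by (intro sum.neutral) blast
  finally show "(\<Sum>(a, B)\<leftarrow>ms. zsmul a (tutte n B)) = 0" .
qed

lemma tutte_isomorphic:
  assumes B: "is_matroid n B" and \<sigma>: "bij_betw \<sigma> {0..<n} {0..<n}"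
  shows "tutte n ((\<lambda>b. \<sigma> ` b) ` B) = tutte n B"
proof -
  have inj: "inj_on \<sigma> {0..<n}" and img: "\<sigma> ` {0..<n} = {0..<n}" using \<sigma> by (auto simp: bij_betw_def)
  have rk: "mrank ((\<lambda>b. \<sigma> ` b) ` B) (\<sigma> ` A) = mrank B A" if A: "A \<subseteq> {0..<n}" for A
  proof -
    have "card (\<sigma> ` b \<inter> \<sigma> ` A) = card (b \<inter> A)" if "b \<in> B" for b
    proof -
      have b: "b \<subseteq> {0..<n}" using B that unfolding is_matroid_def by blast
      hence "\<sigma> ` b \<inter> \<sigma> ` A = \<sigma> ` (b \<inter> A)" using inj_on_image_Int[OF inj b A] by simp
      moreover have "inj_on \<sigma> (b \<inter> A)" using inj b by (meson inf_le1 inj_on_subset order_trans)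
      ultimately show ?thesis by (simp add: card_image)
    qed
    thus ?thesis unfolding mrank_def image_image by (simp cong: image_cong)
  qed
  have rkE: "mrank ((\<lambda>b. \<sigma> ` b) ` B) {0..<n} = mrank B {0..<n}" using rk[of "{0..<n}"] img by simp
  have "bij_betw ((`) \<sigma>) (Pow {0..<n}) (Pow {0..<n})" using bij_betw_Pow[OF \<sigma>] .
  hence "tutte n ((\<lambda>b. \<sigma> ` b) ` B) = (\<Sum>A\<in>Pow {0..<n}.
      [: [:-1, 1:] ^ (mrank B {0..<n} - mrank ((\<lambda>b. \<sigma> ` b) ` B) (\<sigma> ` A)) :] *
      [: -1, 1 :] ^ (card (\<sigma> ` A) - mrank ((\<lambda>b. \<sigma> ` b) ` B) (\<sigma> ` A)))"
    unfolding tutte_def rkE by (rule sum.reindex_bij_betw[symmetric])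
  also have "\<dots> = tutte n B"
    unfolding tutte_def
  proof (rule sum.cong)
    fix A assume "A \<in> Pow {0..<n}"
    hence A: "A \<subseteq> {0..<n}" by simp
    have "card (\<sigma> ` A) = card A" using card_image inj_on_subset[OF inj A] by blast
    thus "[: [:-1, 1:] ^ (mrank B {0..<n} - mrank ((\<lambda>b. \<sigma> ` b) ` B) (\<sigma> ` A)) :] *
      [: -1, 1 :] ^ (card (\<sigma> ` A) - mrank ((\<lambda>b. \<sigma> ` b) ` B) (\<sigma> ` A)) =
      ([: [:-1, 1:] ^ (mrank B {0..<n} - mrank B A) :] * [: -1, 1 :] ^ (card A - mrank B A) :: int poly poly)"
      using rk[OF A] by simp
  qed simp
  finally show ?thesis .
qed

lemma valuative_invariant_tutte: "valuative_invariant tutte"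
  unfolding valuative_invariant_def using valuative_on_tutte tutte_isomorphic by blast

section \<open>Cyclic flats of elementary split matroids\<close>

lemma mrank_W_bases: "mrank W_bases X = of_bool (1 \<in> X \<or> 2 \<in> X) + of_bool (3 \<in> X)"
proof -
  have "card ({i, j} \<inter> X) = of_bool (i \<in> X) + of_bool (j \<in> X)" if "i \<noteq> j" for i j :: nat
    using that by (simp add: Int_insert_left)
  thus ?thesis unfolding mrank_def W_bases_def by simp
qed

context matroid_on
begin

text \<open>The cyclic flats of positive corank and positive nullity: the third condition makes
  \<open>Z\<close> a union of circuits, the fourth makes it closed.\<close>

definition proper_cyclic_flats :: "nat set set" where
  "proper_cyclic_flats = {Z. Z \<subseteq> E \<and> r Z < k \<and> r Z < card Z \<and>
     (\<forall>e\<in>Z. r (Z - {e}) = r Z) \<and> (\<forall>e\<in>E - Z. r (insert e Z) \<noteq> r Z)}"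

text \<open>Minimising first the rank and then the cosize among the sets \<open>Z\<close> with
  \<open>r Z + |A - Z| \<le> r A\<close> removes the coloops of \<open>Z\<close> and closes it.\<close>
lemma mrank_via_cyclic_flat:
  assumes A: "A \<subseteq> E" "r A < k" "r A < card A"
  obtains Z where "Z \<in> proper_cyclic_flats" "r A = r Z + card (A - Z)"
proof -
  have finA: "finite A" using A finite_subset by blast
  \<comment> \<open>The factor \<open>n + 1\<close> exceeds every cosize, so the measure is
    lexicographic.\<close>
  let ?S = "\<lambda>Z. Z \<subseteq> E \<and> r Z + card (A - Z) \<le> r A" and ?\<mu> = "\<lambda>Z. r Z * (n + 1) + (n - card Z)"
  have "?S A" using A by simp
  then obtain Z where Z: "?S Z" and min: "\<And>Y. ?S Y \<Longrightarrow> ?\<mu> Z \<le> ?\<mu> Y"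
    using ex_has_least_nat[of ?S A ?\<mu>] by blast
  have finZ: "finite Z" using Z finite_subset by blast
  have cardZ: "card Z \<le> n" using Z card_mono[of E Z] by simp
  \<comment> \<open>Subadditivity gives the reverse inequality, so an admissible \<open>Z\<close> is
    automatically exact.\<close>
  have eq: "r A = r Z + card (A - Z)"
    using Z mrank_Un_le[OF finA, of Z] mrank_mono[of A "Z \<union> A"] by simp
  have "card A = card (A \<inter> Z) + card (A - Z)" using finA by (simp add: card_Int_Diff)
  moreover have "card (A \<inter> Z) \<le> card Z" using finZ by (intro card_mono) auto
  ultimately have dep: "r Z < card Z" using eq A(3) by linarith
  have cyc: "r (Z - {e}) = r Z" if e: "e \<in> Z" for e
  proof (rule ccontr)
    assume "r (Z - {e}) \<noteq> r Z"
    hence lt: "Suc (r (Z - {e})) \<le> r Z" using mrank_mono[of "Z - {e}" Z] by fastforce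
    have "card (A - (Z - {e})) \<le> card (insert e (A - Z))" using finA by (intro card_mono) auto
    also have "\<dots> \<le> Suc (card (A - Z))" by (rule card_insert_le_m1) auto
    finally have "?S (Z - {e})" using lt Z by auto
    hence "?\<mu> Z \<le> ?\<mu> (Z - {e})" by (rule min)
    moreover have "Suc (r (Z - {e})) * (n + 1) \<le> r Z * (n + 1)" using lt by (rule mult_le_mono1)
    moreover have "card (Z - {e}) = card Z - 1" "card Z > 0" using e finZ card_gt_0_iff by auto
    moreover have "n > 0" using e Z by fastforce
    ultimately show False using cardZ by simp
  qed
  have flat: "r (insert e Z) \<noteq> r Z" if e: "e \<in> E - Z" for e
  proof
    assume eqr: "r (insert e Z) = r Z"
    have "card (A - insert e Z) \<le> card (A - Z)" using finA by (intro card_mono) auto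
    hence "?S (insert e Z)" using Z e eqr by auto
    hence "?\<mu> Z \<le> ?\<mu> (insert e Z)" by (rule min)
    moreover have "card (insert e Z) = Suc (card Z)" using e finZ by simp
    moreover have "card (insert e Z) \<le> n" using Z e card_mono[of E "insert e Z"] by simp
    ultimately show False using eqr by simp
  qed
  show ?thesis
    using that[of Z] eq Z A(2) dep cyc flat unfolding proper_cyclic_flats_def by auto
qed

text \<open>Contract \<open>K\<close> and delete everything else but \<open>e\<close>,
  \<open>a\<close>, \<open>b\<close>, \<open>c\<close>. Then \<open>e\<close> is a loop,
  \<open>a\<close> and \<open>b\<close> are parallel and \<open>c\<close> is a coloop; the
  hypotheses determine the rank of every set between, first without \<open>c\<close> and then with
  it.\<close>

lemma W_minor_of_ranks:
  assumes dist: "distinct [e, a, b, c]" and sub: "K \<subseteq> E" "{e, a, b, c} \<subseteq> E" and disj: "K \<inter> {e, a, b, c} = {}"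
    and e: "r (insert e K) = r K"
    and a: "r (insert a K) = Suc (r K)" and b: "r (insert b K) = Suc (r K)"
    and ab: "r (insert a (insert b K)) = Suc (r K)"
    and c: "\<And>S. S \<subseteq> insert e (insert a (insert b K)) \<Longrightarrow> r (insert c S) = Suc (r S)"
  shows "has_minor_iso n B 4 W_bases"
proof -
  let ?U = "insert e (insert a (insert b K))"
  have U: "r ?U = Suc (r K)"
    using mrank_insert_eq_mono[of K "insert a (insert b K)" e] e ab by auto
  have rk3: "r (T \<union> K) = r K + of_bool (a \<in> T \<or> b \<in> T)" if T: "T \<subseteq> {e, a, b}" for T
  proof (cases "a \<in> T \<or> b \<in> T")
    case True
    hence "insert a K \<subseteq> T \<union> K \<or> insert b K \<subseteq> T \<union> K" by auto
    hence "Suc (r K) \<le> r (T \<union> K)" using mrank_mono a b by metis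
    moreover have "r (T \<union> K) \<le> r ?U" using T by (intro mrank_mono) auto
    ultimately show ?thesis using U True by simp
  next
    case False
    hence "T \<union> K \<subseteq> insert e K" using T by auto
    hence "r (T \<union> K) \<le> r K" using mrank_mono e by metis
    thus ?thesis using mrank_mono[of K "T \<union> K"] False by simp
  qed
  have rk4: "r (T \<union> K) = r K + of_bool (a \<in> T \<or> b \<in> T) + of_bool (c \<in> T)" if T: "T \<subseteq> {e, a, b, c}" for T
  proof (cases "c \<in> T")
    case True
    have "T - {c} \<subseteq> {e, a, b}" using T by auto
    moreover from this have "(T - {c}) \<union> K \<subseteq> ?U" by auto
    moreover have "insert c ((T - {c}) \<union> K) = T \<union> K" using True by auto
    ultimately have "r (T \<union> K) = Suc (r K + of_bool (a \<in> T - {c} \<or> b \<in> T - {c}))"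
      using c[of "(T - {c}) \<union> K"] rk3[of "T - {c}"] by simp
    thus ?thesis using True dist by simp
  next
    case False
    hence "T \<subseteq> {e, a, b}" using T by auto
    from rk3[OF this] show ?thesis using False by simp
  qed
  \<comment> \<open>The order matches \<open>W_bases\<close>: loop 0, parallel pair 1 and 2, coloop
    3.\<close>
  let ?\<sigma> = "(!) [e, a, b, c]"
  have bij: "bij_betw ?\<sigma> {0..<4} {e, a, b, c}"
    using dist by (intro bij_betw_nth) auto
  have mem: "?\<sigma> i \<in> ?\<sigma> ` X \<longleftrightarrow> i \<in> X" if "X \<subseteq> {0..<4}" "i \<in> {0..<4}" for X i
    using inj_on_image_mem_iff[OF bij_betw_imp_inj_on[OF bij] that(2,1)] .
  have "r (?\<sigma> ` X \<union> K) - r K = mrank W_bases X" if X: "X \<subseteq> {0..<4}" for X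
  proof -
    have "?\<sigma> ` X \<subseteq> {e, a, b, c}" using bij X unfolding bij_betw_def by blast
    from rk4[OF this] show ?thesis
      using mem[OF X, of 1] mem[OF X, of 2] mem[OF X, of 3] unfolding mrank_W_bases by simp
  qed
  moreover have "E - (K \<union> (E - K - {e, a, b, c})) = {e, a, b, c}" using sub disj by auto
  ultimately show ?thesis
    unfolding has_minor_iso_def using sub bij
    by (intro exI[of _ K] exI[of _ "E - K - {e, a, b, c}"] exI[of _ ?\<sigma>]) auto
qed

text \<open>Dependence of \<open>X\<close> provides the loop \<open>e\<close>, and an element
  outside the closure of \<open>Y\<close> provides the coloop \<open>c\<close>. Between
  \<open>X - {e}\<close> and \<open>Y - {a, e}\<close> the element \<open>a\<close> turns from
  unspanned to spanned. Over a maximal \<open>K\<close> that does not span \<open>a\<close>, any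
  further element \<open>b\<close> is therefore parallel to \<open>a\<close>.\<close>

lemma W_minor_of_chain:
  assumes XY: "X \<subseteq> Y" "Y \<subseteq> E" and dep: "r X < card X" and rkY: "r Y < k"
    and a: "a \<in> Y" "r (insert a X) \<noteq> r X" "r (Y - {a}) = r Y"
  shows "has_minor_iso n B 4 W_bases"
proof -
  \<comment> \<open>A basis attaining \<open>r X\<close> misses an element of the dependent set
    \<open>X\<close>; removing that element keeps the rank.\<close>
  obtain e where e: "e \<in> X" "r (X - {e}) = r X"
  proof -
    obtain b where b: "b \<in> B" "card (b \<inter> X) = r X" by (rule mrank_attained)
    have "b \<inter> X \<noteq> X" using dep b by force
    then obtain e where e: "e \<in> X" "e \<notin> b" by blast
    hence "b \<inter> (X - {e}) = b \<inter> X" by auto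
    hence "r X \<le> r (X - {e})" using card_le_mrank[OF b(1), of "X - {e}"] b(2) by simp
    thus ?thesis using that e mrank_mono[of "X - {e}" X] by fastforce
  qed
  have aX: "a \<notin> X" using a(2) by (auto simp: insert_absorb)
  have ea: "e \<noteq> a" using aX e by auto
  define X0 Y0 where "X0 = X - {e}" and "Y0 = Y - {a, e}"
  have sub: "X0 \<subseteq> Y0" using XY aX unfolding X0_def Y0_def by auto
  have eX0: "r (insert e X0) = r X0" using e unfolding X0_def by (simp add: insert_absorb)
  have "insert e Y0 = Y - {a}" using e XY ea unfolding Y0_def by auto
  hence Y0: "r Y0 = r Y" using mrank_insert_eq_mono[OF sub eX0] a(3) by simp
  have aX0: "r (insert a X0) \<noteq> r X0"
    using mrank_insert_eq_mono[of X0 X a] a(2) unfolding X0_def by blast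
  have aY0: "r (insert a Y0) = r Y0"
  proof -
    have "insert a Y0 \<subseteq> Y" using a unfolding Y0_def by auto
    hence "r (insert a Y0) \<le> r Y" by (rule mrank_mono)
    thus ?thesis using Y0 mrank_mono[OF subset_insertI, of Y0 a] by simp
  qed
  let ?S = "{K. X0 \<subseteq> K \<and> K \<subseteq> Y0 \<and> r (insert a K) \<noteq> r K}"
  have "finite Y0" using XY finite_subset[of Y0 E] unfolding Y0_def by auto
  hence finS: "finite ?S" by simp
  have "X0 \<in> ?S" using sub aX0 by auto
  from finite_has_maximal2[OF finS this]
  obtain K where K: "K \<in> ?S" and max: "\<forall>L\<in>?S. K \<subseteq> L \<longrightarrow> K = L"
    by (elim bexE conjE)
  have "K \<noteq> Y0" using K aY0 by auto
  then obtain b where b: "b \<in> Y0" "b \<notin> K" using K by blast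
  have "insert b K \<notin> ?S" using bspec[OF max, of "insert b K"] b(2) by (metis insertI1 subset_insertI)
  hence ab: "r (insert a (insert b K)) = r (insert b K)" using K b by auto
  have a1: "r (insert a K) = Suc (r K)"
    using K mrank_insert_le[of a K] mrank_mono[of K "insert a K"] by fastforce
  have "r (insert a K) \<le> r (insert a (insert b K))" by (intro mrank_mono) auto
  hence b1: "r (insert b K) = Suc (r K)" using a1 ab mrank_insert_le[of b K] by simp
  have eK: "r (insert e K) = r K" using mrank_insert_eq_mono[of X0 K e] K eX0 by auto
  obtain c where c: "c \<in> E" "r (insert c Y) \<noteq> r Y"
  proof -
    obtain b where b: "b \<in> B" "card (b \<inter> Y) = r Y" by (rule mrank_attained)
    have "b \<inter> Y \<noteq> b" using rkY b card_basis by force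
    then obtain c where c: "c \<in> b" "c \<notin> Y" by blast
    hence "b \<inter> insert c Y = insert c (b \<inter> Y)" by auto
    hence "card (b \<inter> insert c Y) = Suc (r Y)" using c b finite_basis by simp
    hence "r (insert c Y) \<noteq> r Y" using card_le_mrank[OF b(1), of "insert c Y"] by auto
    thus ?thesis using that c b basis_subset by blast
  qed
  have cY: "c \<notin> Y" using c(2) by (auto simp: insert_absorb)
  have UY: "insert e (insert a (insert b K)) \<subseteq> Y" using e a b K XY unfolding Y0_def by auto
  show ?thesis
  proof (rule W_minor_of_ranks[of e a b c K])
    show "distinct [e, a, b, c]" using ea b cY UY unfolding Y0_def by auto
    show "K \<subseteq> E" "{e, a, b, c} \<subseteq> E" using UY XY c by auto
    show "K \<inter> {e, a, b, c} = {}" using K b cY UY unfolding Y0_def by auto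
    show "r (insert c S) = Suc (r S)" if "S \<subseteq> insert e (insert a (insert b K))" for S
    proof -
      have "S \<subseteq> Y" using that UY by auto
      hence "r (insert c S) \<noteq> r S" using mrank_insert_eq_mono[of S Y c] c by blast
      thus ?thesis using mrank_insert_le[of c S] mrank_mono[of S "insert c S"] by fastforce
    qed
  qed (use a1 b1 ab eK in auto)
qed

text \<open>For \<open>a\<close> in \<open>Z1\<close> but not in \<open>Z2\<close>, the chain from
  \<open>Z2\<close> to \<open>Z1 \<union> Z2\<close> forces the union to be spanning, and the chain
  from \<open>Z1 \<inter> Z2\<close> to \<open>Z1\<close> forces the intersection to be independent.
  Submodularity then gives the inequality.\<close>

lemma elementary_split_cyclic_flats:
  assumes es: "elementary_split n B" and Z: "Z1 \<in> proper_cyclic_flats" "Z2 \<in> proper_cyclic_flats" "Z1 \<noteq> Z2"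
  shows "card (Z1 \<inter> Z2) + k \<le> r Z1 + r Z2"
proof -
  \<comment> \<open>The claim is symmetric, and of two distinct flats at least one is not contained
    in the other.\<close>
  have *: "card (Z1 \<inter> Z2) + k \<le> r Z1 + r Z2"
    if Z: "Z1 \<in> proper_cyclic_flats" "Z2 \<in> proper_cyclic_flats" "\<not> Z1 \<subseteq> Z2" for Z1 Z2
  proof -
    obtain a where a: "a \<in> Z1" "a \<notin> Z2" using Z by blast
    have Z1: "Z1 \<subseteq> E" "r Z1 < k" "r (Z1 - {a}) = r Z1"
      and Z2: "Z2 \<subseteq> E" "r Z2 < card Z2" "r (insert a Z2) \<noteq> r Z2"
      using Z a unfolding proper_cyclic_flats_def by auto
    have "k \<le> r (Z1 \<union> Z2)"
    proof (rule ccontr)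
      assume "\<not> k \<le> r (Z1 \<union> Z2)"
      moreover have "r (insert a (Z1 - {a})) = r (Z1 - {a})" using Z1 a by (simp add: insert_absorb)
      hence "r (insert a (Z1 \<union> Z2 - {a})) = r (Z1 \<union> Z2 - {a})"
        by (rule mrank_insert_eq_mono[rotated]) auto
      hence "r (Z1 \<union> Z2 - {a}) = r (Z1 \<union> Z2)" using a by (simp add: insert_absorb)
      ultimately have "has_minor_iso n B 4 W_bases"
        using Z1 Z2 a by (intro W_minor_of_chain[of Z2 "Z1 \<union> Z2" a]) auto
      thus False using es unfolding elementary_split_def by blast
    qed
    moreover have "card (Z1 \<inter> Z2) \<le> r (Z1 \<inter> Z2)"
    proof (rule ccontr)
      assume "\<not> card (Z1 \<inter> Z2) \<le> r (Z1 \<inter> Z2)"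
      moreover have "r (insert a (Z1 \<inter> Z2)) \<noteq> r (Z1 \<inter> Z2)"
        using mrank_insert_eq_mono[of "Z1 \<inter> Z2" Z2 a] Z2(3) by blast
      ultimately have "has_minor_iso n B 4 W_bases"
        using Z1 a by (intro W_minor_of_chain[of "Z1 \<inter> Z2" Z1 a]) auto
      thus False using es unfolding elementary_split_def by blast
    qed
    ultimately show ?thesis using mrank_submodular[of Z1 Z2] by linarith
  qed
  show ?thesis
  proof (cases "Z1 \<subseteq> Z2")
    case True
    hence "\<not> Z2 \<subseteq> Z1" using Z by blast
    from *[OF Z(2,1) this] show ?thesis by (simp add: Int_commute)
  qed (use *[OF Z(1,2)] in blast)
qed

end

section \<open>Cutting the hypersimplex\<close>

definition hypersimplex :: "nat \<Rightarrow> nat \<Rightarrow> (nat \<Rightarrow> real) set" where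
  "hypersimplex n k = {x. (\<forall>i. 0 \<le> x i \<and> x i \<le> 1) \<and> (\<forall>i\<ge>n. x i = 0) \<and> sum x {0..<n} = k}"

text \<open>Each rank inequality follows from the cube bounds, from the total sum \<open>k\<close>,
  or from the cut at some \<open>H\<close> plus cube bounds on \<open>A - H\<close>. The bound
  \<open>s\<close> is kept apart from the rank because the bound defining a cut matroid may exceed
  the rank of \<open>H\<close>.\<close>

lemma (in matroid_on) base_polytope_cuts:
  assumes Hs: "\<And>H. H \<in> Hs \<Longrightarrow> H \<subseteq> E \<and> r H \<le> s H"
    and rk: "\<And>A. A \<subseteq> E \<Longrightarrow> card A \<le> r A \<or> k \<le> r A \<or> (\<exists>H\<in>Hs. s H + card (A - H) \<le> r A)"
  shows "base_polytope B = {x \<in> hypersimplex n k. \<forall>H\<in>Hs. sum x H \<le> s H}"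
  unfolding base_polytope_eq
proof (intro equalityI subsetI)
  fix x assume x: "x \<in> rank_polytope"
  have "x i \<le> 1" for i using x by (rule rank_polytope_le_1)
  moreover have "sum x H \<le> s H" if "H \<in> Hs" for H
    using rank_polytope_le[OF x, of H] Hs[OF that] by linarith
  ultimately show "x \<in> {x \<in> hypersimplex n k. \<forall>H\<in>Hs. sum x H \<le> s H}"
    using x unfolding rank_polytope_def hypersimplex_def by blast
next
  fix x assume "x \<in> {x \<in> hypersimplex n k. \<forall>H\<in>Hs. sum x H \<le> s H}"
  hence x: "x \<in> hypersimplex n k" and xH: "\<And>H. H \<in> Hs \<Longrightarrow> sum x H \<le> s H" by auto
  have nonneg: "0 \<le> x i" and le1: "x i \<le> 1" for i using x unfolding hypersimplex_def by auto
  have sum_card: "sum x A \<le> card A" for A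
    using sum_bounded_above[of A x 1] le1 by simp
  have "sum x A \<le> r A" if A: "A \<subseteq> E" for A
  proof -
    have finA: "finite A" using A finite_subset by blast
    consider "card A \<le> r A" | "k \<le> r A" | H where "H \<in> Hs" "s H + card (A - H) \<le> r A"
      using rk[OF A] by blast
    thus ?thesis
    proof cases
      case 1
      thus ?thesis using sum_card[of A] by linarith
    next
      case 2
      have "sum x A \<le> sum x E" using A nonneg by (intro sum_mono2) auto
      thus ?thesis using 2 x unfolding hypersimplex_def by simp
    next
      case 3
      have finH: "finite H" using Hs[OF 3(1)] finite_subset by blast
      have "sum x A = sum x (A \<inter> H) + sum x (A - H)" using finA by (rule sum.Int_Diff)
      also have "sum x (A \<inter> H) \<le> sum x H" using finH nonneg by (intro sum_mono2) auto
      finally show ?thesis using 3(2) xH[OF 3(1)] sum_card[of "A - H"] by linarith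
    qed
  qed
  thus "x \<in> rank_polytope" using x unfolding rank_polytope_def hypersimplex_def by blast
qed

section \<open>Uniform matroids with one additional bound\<close>

lemma card_exchange: "finite S \<Longrightarrow> e \<in> S \<Longrightarrow> f \<notin> S \<Longrightarrow> card (insert f (S - {e})) = card S"
  by (metis Diff_iff card_Suc_Diff1 card_insert_disjoint finite_Diff)

text \<open>Its polytope is what one cut leaves of the hypersimplex. The choice
  \<open>H = {}\<close>, \<open>s = 0\<close> gives the uniform matroid of rank
  \<open>k\<close>.\<close>

definition cut_matroid :: "nat \<Rightarrow> nat \<Rightarrow> nat set \<Rightarrow> nat \<Rightarrow> nat set set" where
  "cut_matroid n k H s = {b. b \<subseteq> {0..<n} \<and> card b = k \<and> card (b \<inter> H) \<le> s}"

text \<open>An incoming element outside \<open>H\<close> never raises the trace on \<open>H\<close>.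
  If there is none, then \<open>b2 - H\<close> lies in \<open>b1 - H\<close>: for \<open>e\<close>
  in \<open>H\<close> the trace does not grow, and for \<open>e\<close> outside \<open>H\<close> the
  inclusion is strict, so \<open>b1\<close> has fewer than \<open>s\<close> elements in
  \<open>H\<close> and there is room for one more.\<close>

lemma cut_matroid_in_matroids:
  assumes ne: "cut_matroid n k H s \<noteq> {}"
  shows "cut_matroid n k H s \<in> matroids n k"
proof -
  let ?N = "cut_matroid n k H s"
  have "\<exists>f\<in>b2 - b1. insert f (b1 - {e}) \<in> ?N" if b: "b1 \<in> ?N" "b2 \<in> ?N" "e \<in> b1 - b2" for b1 b2 e
  proof -
    have sub: "b1 \<subseteq> {0..<n}" "b2 \<subseteq> {0..<n}" and card: "card b1 = k" "card b2 = k"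
      and H: "card (b1 \<inter> H) \<le> s" "card (b2 \<inter> H) \<le> s"
      using b unfolding cut_matroid_def by auto
    have fin: "finite b1" "finite b2" using sub finite_subset by blast+
    have swap: "insert f (b1 - {e}) \<in> ?N"
      if f: "f \<in> b2 - b1" and c: "card (insert f (b1 - {e}) \<inter> H) \<le> s" for f
    proof -
      have "card (insert f (b1 - {e})) = k" using f fin b(3) card card_exchange[of b1 e f] by simp
      thus ?thesis using f c sub unfolding cut_matroid_def by auto
    qed
    show ?thesis
    proof (cases "\<exists>f\<in>b2 - b1. f \<notin> H")
      case True
      then obtain f where f: "f \<in> b2 - b1" "f \<notin> H" by blast
      have "card (insert f (b1 - {e}) \<inter> H) \<le> card (b1 \<inter> H)" using f fin by (intro card_mono) auto
      thus ?thesis using swap[OF f(1)] H f(1) by auto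
    next
      case False
      hence sub2: "b2 - H \<subseteq> b1 - H" by auto
      have split: "card b1 = card (b1 \<inter> H) + card (b1 - H)" "card b2 = card (b2 \<inter> H) + card (b2 - H)"
        using fin by (simp_all add: card_Int_Diff)
      have "b2 - b1 \<noteq> {}"
      proof
        assume "b2 - b1 = {}"
        hence "b2 = b1" using fin card by (intro card_subset_eq) auto
        thus False using b by blast
      qed
      then obtain f where f: "f \<in> b2 - b1" by blast
      have "card (insert f (b1 - {e}) \<inter> H) \<le> s"
      proof (cases "e \<in> H")
        case True
        have "card (insert f (b1 - {e}) \<inter> H) \<le> card (insert f (b1 \<inter> H - {e}))"
          using fin by (intro card_mono) auto
        also have "\<dots> = card (b1 \<inter> H)" using fin f b(3) True by (intro card_exchange) auto
        finally show ?thesis using H by simp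
      next
        case e: False
        hence "b2 - H \<subset> b1 - H" using sub2 b(3) by blast
        hence "card (b2 - H) < card (b1 - H)" using fin by (intro psubset_card_mono) auto
        hence "card (b1 \<inter> H) < s"
          using split card H by linarith
        moreover have "card (insert f (b1 - {e}) \<inter> H) \<le> card (insert f (b1 \<inter> H))"
          using fin by (intro card_mono) auto
        moreover have "card (insert f (b1 \<inter> H)) \<le> Suc (card (b1 \<inter> H))"
          using fin by (simp add: card_insert_if)
        ultimately show ?thesis by linarith
      qed
      thus ?thesis using swap[OF f] f by blast
    qed
  qed
  thus ?thesis using ne unfolding matroids_def is_matroid_def by (auto simp: cut_matroid_def)
qed

text \<open>Let \<open>b\<close> attain \<open>r A\<close> without containing \<open>A\<close> or
  lying in it. Exchanging \<open>f\<close> in \<open>b - A\<close> for \<open>e\<close> in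
  \<open>A - b\<close> must violate the bound, which puts \<open>A - b\<close> inside
  \<open>H\<close>, puts \<open>b - A\<close> outside \<open>H\<close>, and makes \<open>b\<close>
  meet \<open>H\<close> in \<open>s\<close> elements. Hence \<open>r A\<close> is at least
  \<open>s + card (A - H)\<close>.\<close>

lemma base_polytope_cut_matroid:
  assumes ne: "cut_matroid n k H s \<noteq> {}" and H: "H \<subseteq> {0..<n}"
  shows "base_polytope (cut_matroid n k H s) = {x \<in> hypersimplex n k. sum x H \<le> s}"
proof -
  let ?N = "cut_matroid n k H s"
  interpret matroid_on n k ?N using cut_matroid_in_matroids[OF ne] by unfold_locales
  have "card A \<le> r A \<or> k \<le> r A \<or> s + card (A - H) \<le> r A" if A: "A \<subseteq> E" for A
  proof (rule ccontr)
    assume not: "\<not> ?thesis"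
    obtain b where b: "b \<in> ?N" "card (b \<inter> A) = r A" by (rule mrank_attained)
    have fin: "finite A" "finite b" using A finite_subset b finite_basis by blast+
    have bH: "card (b \<inter> H) \<le> s" using b unfolding cut_matroid_def by simp
    have "b \<inter> A \<noteq> A" "b \<inter> A \<noteq> b" using not b card_basis by force+
    then obtain e0 f0 where e0: "e0 \<in> A - b" and f0: "f0 \<in> b - A" by blast
    have big: "s < card (insert e (b - {f}) \<inter> H)" if e: "e \<in> A - b" and f: "f \<in> b - A" for e f
    proof (rule ccontr)
      assume "\<not> ?thesis"
      moreover have "card (insert e (b - {f})) = k"
        using e f fin card_basis[OF b(1)] card_exchange[of b f e] by simp
      ultimately have "insert e (b - {f}) \<in> ?N"
        using A e basis_subset[OF b(1)] unfolding cut_matroid_def by auto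
      moreover have "insert e (b - {f}) \<inter> A = insert e (b \<inter> A)" using e f by auto
      hence "card (insert e (b - {f}) \<inter> A) = Suc (r A)" using e b fin by simp
      ultimately show False using card_le_mrank[of "insert e (b - {f})" A] by simp
    qed
    have eH: "e \<in> H" if "e \<in> A - b" for e
    proof (rule ccontr)
      assume "e \<notin> H"
      hence "card (insert e (b - {f0}) \<inter> H) \<le> card (b \<inter> H)" using fin by (intro card_mono) auto
      thus False using big[OF that f0] bH by simp
    qed
    have fH: "f \<notin> H" if "f \<in> b - A" for f
    proof
      assume f: "f \<in> H"
      have "card (insert e0 (b - {f}) \<inter> H) \<le> card (insert e0 (b \<inter> H - {f}))"
        using fin by (intro card_mono) auto
      also have "\<dots> = card (b \<inter> H)" using fin e0 f that by (intro card_exchange) auto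
      finally show False using big[OF e0 that] bH by simp
    qed
    have "card (insert e0 (b - {f0}) \<inter> H) \<le> card (insert e0 (b \<inter> H))" using fin by (intro card_mono) auto
    also have "\<dots> \<le> Suc (card (b \<inter> H))" using fin by (simp add: card_insert_if)
    finally have "s \<le> card (b \<inter> H)" using big[OF e0 f0] by simp
    moreover have "card (b \<inter> A) = card (b \<inter> A \<inter> H) + card (b \<inter> A - H)" using fin by (simp add: card_Int_Diff)
    moreover have "b \<inter> A \<inter> H = b \<inter> H" "b \<inter> A - H = A - H" using eH fH by auto
    ultimately show False using not b by simp
  qed
  moreover have "r H \<le> s" by (intro mrank_leI) (simp add: cut_matroid_def)
  ultimately show ?thesis using base_polytope_cuts[of "{H}" "\<lambda>_. s"] H by simp
qed

lemma bij_betw_initial_segment: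
  assumes "H \<subseteq> {0..<n}"
  obtains \<sigma> where "bij_betw \<sigma> {0..<n} {0..<n}" "\<sigma> ` H = {0..<card H}"
proof -
  have fin: "finite H" using assms finite_subset by blast
  have le: "card H \<le> n" using assms card_mono[of "{0..<n}" H] by simp
  obtain g1 where g1: "bij_betw g1 H {0..<card H}"
    using finite_same_card_bij[of H "{0..<card H}"] fin by auto
  have "card ({0..<n} - H) = card {card H..<n}" using assms fin by (simp add: card_Diff_subset)
  then obtain g2 where g2: "bij_betw g2 ({0..<n} - H) {card H..<n}"
    using finite_same_card_bij[of "{0..<n} - H" "{card H..<n}"] by auto
  let ?\<sigma> = "\<lambda>x. if x \<in> H then g1 x else g2 x"
  have "bij_betw ?\<sigma> (H \<union> ({0..<n} - H)) ({0..<card H} \<union> {card H..<n})"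
    using g1 g2 by (intro bij_betw_disjoint_Un) auto
  moreover have "H \<union> ({0..<n} - H) = {0..<n}" "{0..<card H} \<union> {card H..<n} = {0..<n}" using assms le by auto
  moreover have "?\<sigma> ` H = {0..<card H}" using g1 by (simp add: bij_betw_def)
  ultimately show ?thesis using that by simp
qed

lemma cut_matroid_image:
  assumes \<sigma>: "bij_betw \<sigma> {0..<n} {0..<n}" and H: "H \<subseteq> {0..<n}"
  shows "(\<lambda>b. \<sigma> ` b) ` cut_matroid n k H s = cut_matroid n k (\<sigma> ` H) s"
proof -
  have inj: "inj_on \<sigma> {0..<n}" and img: "\<sigma> ` {0..<n} = {0..<n}" using \<sigma> by (auto simp: bij_betw_def)
  have cardi: "card (\<sigma> ` A) = card A" if "A \<subseteq> {0..<n}" for A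
    using card_image inj_on_subset[OF inj that] by blast
  have int: "card (\<sigma> ` b \<inter> \<sigma> ` H) = card (b \<inter> H)" if b: "b \<subseteq> {0..<n}" for b
  proof -
    have "\<sigma> ` b \<inter> \<sigma> ` H = \<sigma> ` (b \<inter> H)" using inj_on_image_Int[OF inj b H] by simp
    thus ?thesis using cardi[of "b \<inter> H"] b by auto
  qed
  have iff: "\<sigma> ` b \<in> cut_matroid n k (\<sigma> ` H) s \<longleftrightarrow> b \<in> cut_matroid n k H s" if b: "b \<subseteq> {0..<n}" for b
  proof -
    have "\<sigma> ` b \<subseteq> {0..<n}" using b img by blast
    thus ?thesis using b cardi[OF b] int[OF b] unfolding cut_matroid_def by simp
  qed
  show ?thesis
  proof (intro equalityI subsetI)
    fix c assume "c \<in> (\<lambda>b. \<sigma> ` b) ` cut_matroid n k H s"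
    then obtain b where b: "b \<in> cut_matroid n k H s" "c = \<sigma> ` b" by blast
    moreover have "b \<subseteq> {0..<n}" using b(1) unfolding cut_matroid_def by simp
    ultimately show "c \<in> cut_matroid n k (\<sigma> ` H) s" using iff by blast
  next
    fix c assume c: "c \<in> cut_matroid n k (\<sigma> ` H) s"
    hence "c \<subseteq> \<sigma> ` {0..<n}" unfolding img cut_matroid_def by simp
    then obtain b where b: "b \<subseteq> {0..<n}" "c = \<sigma> ` b" by (rule subset_imageE)
    thus "c \<in> (\<lambda>b. \<sigma> ` b) ` cut_matroid n k H s" using iff c by blast
  qed
qed

text \<open>A permutation of the ground set moves \<open>H\<close> to an initial segment, so only
  its size matters.\<close>

lemma invariant_cut_matroid:
  assumes f: "valuative_invariant f" and ne: "cut_matroid n k H s \<noteq> {}" and H: "H \<subseteq> {0..<n}"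
  shows "f n (cut_matroid n k H s) = f n (cut_matroid n k {0..<card H} s)"
proof -
  obtain \<sigma> where \<sigma>: "bij_betw \<sigma> {0..<n} {0..<n}" "\<sigma> ` H = {0..<card H}"
    using bij_betw_initial_segment[OF H] by blast
  have "is_matroid n (cut_matroid n k H s)"
    using cut_matroid_in_matroids[OF ne] unfolding matroids_def by blast
  hence "f n ((\<lambda>b. \<sigma> ` b) ` cut_matroid n k H s) = f n (cut_matroid n k H s)"
    using f \<sigma>(1) unfolding valuative_invariant_def by blast
  thus ?thesis using cut_matroid_image[OF \<sigma>(1) H] \<sigma>(2) by simp
qed

section \<open>The polytope of an elementary split matroid as a signed sum\<close>

context matroid_on
begin

lemma finite_proper_cyclic_flats: "finite proper_cyclic_flats"
proof -
  have "proper_cyclic_flats \<subseteq> Pow E" unfolding proper_cyclic_flats_def by blast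
  thus ?thesis by (rule finite_subset) simp
qed

lemma base_polytope_cyclic_flats:
  "base_polytope B = {x \<in> hypersimplex n k. \<forall>H\<in>proper_cyclic_flats. sum x H \<le> r H}"
proof (rule base_polytope_cuts[where s = r])
  fix A assume A: "A \<subseteq> E"
  show "card A \<le> r A \<or> k \<le> r A \<or> (\<exists>H\<in>proper_cyclic_flats. r H + card (A - H) \<le> r A)"
  proof (cases "card A \<le> r A \<or> k \<le> r A")
    case False
    hence "r A < k" "r A < card A" by auto
    then obtain Z where "Z \<in> proper_cyclic_flats" "r A = r Z + card (A - Z)"
      using mrank_via_cyclic_flat[OF A] by blast
    thus ?thesis by auto
  qed blast
qed (auto simp: proper_cyclic_flats_def)

lemma cut_matroid_nonempty: "cut_matroid n k H (r H) \<noteq> {}"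
proof -
  obtain b where b: "b \<in> B" using bases_nonempty by blast
  hence "b \<in> cut_matroid n k H (r H)"
    using basis_subset card_basis card_le_mrank unfolding cut_matroid_def by simp
  thus ?thesis by blast
qed

lemma cut_matroid_uniform_nonempty: "cut_matroid n k {} 0 \<noteq> {}"
proof -
  obtain b where b: "b \<in> B" using bases_nonempty by blast
  hence "b \<in> cut_matroid n k {} 0"
    using basis_subset card_basis unfolding cut_matroid_def by simp
  thus ?thesis by blast
qed

text \<open>Two violations would make \<open>sum x H + sum x H'\<close> exceed
  \<open>r H + r H'\<close>, but modularity bounds it by
  \<open>k + card (H \<inter> H')\<close>.\<close>

lemma at_most_one_violation:
  fixes x :: "nat \<Rightarrow> real"
  assumes es: "elementary_split n B" and x: "x \<in> hypersimplex n k"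
    and H: "H \<in> proper_cyclic_flats" "r H < sum x H" and H': "H' \<in> proper_cyclic_flats" "r H' < sum x H'"
  shows "H = H'"
proof (rule ccontr)
  assume "H \<noteq> H'"
  hence le: "card (H \<inter> H') + k \<le> r H + r H'" using elementary_split_cyclic_flats es H H' by blast
  have sub: "H \<subseteq> E" "H' \<subseteq> E" using H H' unfolding proper_cyclic_flats_def by auto
  hence "finite H" "finite H'" using finite_subset by blast+
  hence "sum x (H \<union> H') + sum x (H \<inter> H') = sum x H + sum x H'" by (rule sum.union_inter)
  moreover have "sum x (H \<union> H') \<le> sum x E" using sub x unfolding hypersimplex_def by (intro sum_mono2) auto
  moreover have "sum x E = k" using x unfolding hypersimplex_def by blast
  moreover have "sum x (H \<inter> H') \<le> card (H \<inter> H')"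
    using sum_bounded_above[of "H \<inter> H'" x 1] x unfolding hypersimplex_def by simp
  ultimately show False using H H' le by linarith
qed

text \<open>Off the hypersimplex everything vanishes. On it, the summand at \<open>H\<close>
  indicates that the inequality at \<open>H\<close> is violated, so at most one summand is nonzero,
  and one is exactly if \<open>x\<close> lies outside the polytope.\<close>

lemma indicator_base_polytope:
  assumes es: "elementary_split n B"
  shows "indicator (base_polytope B) x = indicat_real (base_polytope (cut_matroid n k {} 0)) x -
    (\<Sum>H\<in>proper_cyclic_flats. indicator (base_polytope (cut_matroid n k {} 0)) x -
       indicator (base_polytope (cut_matroid n k H (r H))) x)"
proof (cases "x \<in> hypersimplex n k")
  case False
  thus ?thesis using cut_matroid_nonempty cut_matroid_uniform_nonempty
    by (simp add: base_polytope_cut_matroid base_polytope_cyclic_flats proper_cyclic_flats_def)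
next
  case True
  have U: "indicat_real (base_polytope (cut_matroid n k {} 0)) x = 1"
    using True cut_matroid_uniform_nonempty by (simp add: base_polytope_cut_matroid)
  have N: "indicat_real (base_polytope (cut_matroid n k H (r H))) x = of_bool (sum x H \<le> r H)"
    if "H \<in> proper_cyclic_flats" for H
    using True cut_matroid_nonempty that
    by (simp add: base_polytope_cut_matroid proper_cyclic_flats_def indicator_def)
  show ?thesis
  proof (cases "\<exists>H\<in>proper_cyclic_flats. r H < sum x H")
    case True
    then obtain H0 where H0: "H0 \<in> proper_cyclic_flats" "r H0 < sum x H0" by blast
    have "(\<Sum>H\<in>proper_cyclic_flats. 1 - indicat_real (base_polytope (cut_matroid n k H (r H))) x) =
        (\<Sum>H\<in>proper_cyclic_flats. if H = H0 then 1 else 0)"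
    proof (rule sum.cong)
      fix H assume H: "H \<in> proper_cyclic_flats"
      have "sum x H \<le> r H" if "H \<noteq> H0"
        using at_most_one_violation[OF es \<open>x \<in> _\<close> H _ H0] that by force
      thus "1 - indicat_real (base_polytope (cut_matroid n k H (r H))) x = (if H = H0 then 1 else 0)"
        using N[OF H] H0(2) by auto
    qed simp
    moreover have "x \<notin> base_polytope B" using H0 unfolding base_polytope_cyclic_flats by force
    ultimately show ?thesis using H0(1) finite_proper_cyclic_flats unfolding U by simp
  next
    case False
    hence "x \<in> base_polytope B" using \<open>x \<in> hypersimplex n k\<close> unfolding base_polytope_cyclic_flats by force
    moreover have "indicat_real (base_polytope (cut_matroid n k H (r H))) x = 1"
      if "H \<in> proper_cyclic_flats" for H using N[OF that] False that by force
    ultimately show ?thesis unfolding U by simp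
  qed
qed

lemma valuation_formula:
  assumes es: "elementary_split n B" and f: "valuative_on n k f"
  shows "f B = f (cut_matroid n k {} 0) -
    (\<Sum>H\<in>proper_cyclic_flats. f (cut_matroid n k {} 0) - f (cut_matroid n k H (r H)))"
proof -
  let ?U = "cut_matroid n k {} 0" and ?N = "\<lambda>H. cut_matroid n k H (r H)"
  obtain hs where hs: "set hs = proper_cyclic_flats" "distinct hs"
    using finite_distinct_list[OF finite_proper_cyclic_flats] by blast
  \<comment> \<open>The relation of \<open>indicator_base_polytope\<close> brought to one side, with
    every coefficient 1 or -1.\<close>
  let ?ms = "[(1, B), (-1, ?U)] @ map (\<lambda>H. (1, ?U)) hs @ map (\<lambda>H. (-1, ?N H)) hs :: (int \<times> nat set set) list"
  have sum_hs: "sum_list (map g hs) = sum g proper_cyclic_flats" for g :: "nat set \<Rightarrow> 'c :: comm_monoid_add"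
    using hs sum_list_distinct_conv_sum_set by metis
  have "\<forall>(a, M)\<in>set ?ms. M \<in> matroids n k"
    using bases cut_matroid_in_matroids[OF cut_matroid_nonempty]
      cut_matroid_in_matroids[OF cut_matroid_uniform_nonempty] by auto
  moreover have "(\<Sum>(a, M)\<leftarrow>?ms. real_of_int a * indicator (base_polytope M) x) = 0" for x
    unfolding map_append sum_list_append map_map o_def split_conv sum_hs
    by (simp add: indicator_base_polytope[OF es] sum_subtractf sum_negf)
  ultimately have "(\<Sum>(a, M)\<leftarrow>?ms. zsmul a (f M)) = 0"
    using f unfolding valuative_on_def by blast
  hence "f B - f ?U + ((\<Sum>H\<in>proper_cyclic_flats. f ?U) - (\<Sum>H\<in>proper_cyclic_flats. f (?N H))) = 0"
    unfolding map_append sum_list_append map_map o_def split_conv sum_hs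
    by (simp add: sum_negf)
  thus ?thesis unfolding sum_subtractf by (simp add: algebra_simps)
qed

end

section \<open>Corank-nullity coefficients and universality\<close>

lemma card_subsets_split:
  assumes "finite S" "H \<subseteq> S"
  shows "card {A. A \<subseteq> S \<and> card (A \<inter> H) = p \<and> card (A - H) = q} = (card H choose p) * (card (S - H) choose q)"
proof -
  have fin: "finite H" using assms finite_subset by blast
  let ?P = "{X. X \<subseteq> H \<and> card X = p} \<times> {Y. Y \<subseteq> S - H \<and> card Y = q}"
  have "bij_betw (\<lambda>A. (A \<inter> H, A - H)) {A. A \<subseteq> S \<and> card (A \<inter> H) = p \<and> card (A - H) = q} ?P"
  proof (rule bij_betwI[where g = "\<lambda>(X, Y). X \<union> Y"])
    have "(X \<union> Y) \<inter> H = X" "(X \<union> Y) - H = Y" if "X \<subseteq> H" "Y \<subseteq> S - H" for X Y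
      using that by auto
    thus "(\<lambda>(X, Y). X \<union> Y) \<in> ?P \<rightarrow> {A. A \<subseteq> S \<and> card (A \<inter> H) = p \<and> card (A - H) = q}"
      using assms by auto
  qed (use assms in auto)
  hence "card {A. A \<subseteq> S \<and> card (A \<inter> H) = p \<and> card (A - H) = q} = card ?P"
    by (rule bij_betw_same_card)
  thus ?thesis using assms fin by (simp add: card_cartesian_product n_subsets)
qed

text \<open>Substituting \<open>x + 1\<close> and \<open>y + 1\<close> turns the Tutte polynomial
  into the corank-nullity generating polynomial; this is its coefficient at \<open>x^j y^i\<close>,
  with the outer variable \<open>y\<close> treated first.\<close>

definition corank_nullity_coeff :: "nat \<Rightarrow> nat \<Rightarrow> int poly poly \<Rightarrow> int" where
  "corank_nullity_coeff j i p = coeff (pcompose (coeff (pcompose p [:1, 1:]) i) [:1, 1:]) j"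

lemma corank_nullity_coeff_add:
  "corank_nullity_coeff j i (p + q) = corank_nullity_coeff j i p + corank_nullity_coeff j i q"
  by (simp add: corank_nullity_coeff_def pcompose_add)

lemma corank_nullity_coeff_sum:
  "corank_nullity_coeff j i (sum g S) = (\<Sum>s\<in>S. corank_nullity_coeff j i (g s))"
  by (simp add: corank_nullity_coeff_def pcompose_sum coeff_sum)

lemma pcompose_shift_power:
  "pcompose ([:-1, 1:] ^ m) [:1, 1:] = (monom 1 m :: 'a :: comm_ring_1 poly)"
proof (induction m)
  case 0
  show ?case by (simp add: pcompose_1)
next
  case (Suc m)
  have "pcompose [:-1, 1:] [:1, 1:] = (monom 1 1 :: 'a poly)"
    by (simp add: pcompose_pCons monom_altdef)
  thus ?case using Suc unfolding power_Suc pcompose_mult by (simp add: mult_monom)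
qed

lemma corank_nullity_coeff_term:
  "corank_nullity_coeff j i ([: [:-1, 1:] ^ a :] * [:-1, 1:] ^ b) = of_bool (a = j \<and> b = i)"
  by (auto simp: corank_nullity_coeff_def pcompose_smult pcompose_shift_power)

lemma corank_nullity_coeff_tutte:
  "corank_nullity_coeff j i (tutte n B) =
    int (card {A. A \<subseteq> {0..<n} \<and> mrank B {0..<n} - mrank B A = j \<and> card A - mrank B A = i})"
proof -
  have "corank_nullity_coeff j i (tutte n B) =
      (\<Sum>A\<in>Pow {0..<n}. of_bool (mrank B {0..<n} - mrank B A = j \<and> card A - mrank B A = i))"
    unfolding tutte_def corank_nullity_coeff_sum corank_nullity_coeff_term ..
  also have "\<dots> = int (card (Pow {0..<n} \<inter> {A. mrank B {0..<n} - mrank B A = j \<and> card A - mrank B A = i}))"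
    by (subst sum_of_bool_eq) auto
  also have "Pow {0..<n} \<inter> {A. mrank B {0..<n} - mrank B A = j \<and> card A - mrank B A = i} =
      {A. A \<subseteq> {0..<n} \<and> mrank B {0..<n} - mrank B A = j \<and> card A - mrank B A = i}" by auto
  finally show ?thesis .
qed

text \<open>The number of sets of corank \<open>j\<close> and nullity \<open>i\<close> that are accounted for by a cyclic flat
  of corank \<open>J\<close> and nullity \<open>I\<close>, hence of rank \<open>k - J\<close> and size \<open>k - J + I\<close>.\<close>
definition flat_count :: "nat \<Rightarrow> nat \<Rightarrow> nat \<times> nat \<Rightarrow> nat \<times> nat \<Rightarrow> int" where
  "flat_count n k = (\<lambda>(J, I) (j, i). int (if j \<le> J
     then ((k - J + I) choose (k - J + i)) * ((n - (k - J + I)) choose (J - j)) else 0))"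

section \<open>Counting sets of given corank and nullity\<close>

context matroid_on
begin

text \<open>Otherwise \<open>card (A \<inter> Z)\<close> is at most
  \<open>card (H \<inter> Z) + card (A - H)\<close>, which the inequality for distinct flats makes
  smaller than \<open>r Z\<close>.\<close>

lemma cyclic_flat_unique:
  assumes es: "elementary_split n B" and A: "finite A"
    and H: "H \<in> proper_cyclic_flats" "r H + card (A - H) < k"
    and Z: "Z \<in> proper_cyclic_flats" "r Z < card (A \<inter> Z)"
  shows "H = Z"
proof (rule ccontr)
  assume "H \<noteq> Z"
  hence le: "card (H \<inter> Z) + k \<le> r H + r Z" using elementary_split_cyclic_flats es H Z by blast
  have "finite H" using H(1) finite_subset[of H E] unfolding proper_cyclic_flats_def by auto
  hence "card (A \<inter> Z) \<le> card ((H \<inter> Z) \<union> (A - H))" using A by (intro card_mono) auto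
  also have "\<dots> \<le> card (H \<inter> Z) + card (A - H)" by (rule card_Un_le)
  finally show False using le H Z by linarith
qed

text \<open>Positive \<open>j\<close> and \<open>i\<close> mean that \<open>A\<close> is
  non-spanning and dependent, so \<open>A\<close> has a cyclic flat \<open>H\<close>, which fixes
  the sizes of \<open>A \<inter> H\<close> and \<open>A - H\<close>. Conversely, these sizes force
  \<open>H\<close> to be the flat of \<open>A\<close> by \<open>cyclic_flat_unique\<close>, and they
  determine \<open>r A\<close>. The resulting classes are disjoint.\<close>

lemma corank_nullity_count:
  assumes es: "elementary_split n B" and ij: "0 < j" "0 < i"
  shows "int (card {A. A \<subseteq> E \<and> k - r A = j \<and> card A - r A = i}) =
    (\<Sum>H\<in>proper_cyclic_flats. flat_count n k (k - r H, card H - r H) (j, i))"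
proof -
  \<comment> \<open>Adding \<open>j\<close> on the left avoids truncated subtraction: the class is
    empty if \<open>j\<close> exceeds the corank of \<open>H\<close>.\<close>
  let ?S = "\<lambda>H. {A. A \<subseteq> E \<and> card (A \<inter> H) = r H + i \<and> card (A - H) + j = k - r H}"
  have split: "card A = card (A \<inter> H) + card (A - H)" if "A \<subseteq> E" for A H
    using finite_subset[OF that] by (simp add: card_Int_Diff)
  have "{A. A \<subseteq> E \<and> k - r A = j \<and> card A - r A = i} = (\<Union>H\<in>proper_cyclic_flats. ?S H)"
  proof (intro equalityI subsetI)
    fix A assume "A \<in> {A. A \<subseteq> E \<and> k - r A = j \<and> card A - r A = i}"
    hence A: "A \<subseteq> E" "k - r A = j" "card A - r A = i" by auto
    hence "r A < k" "r A < card A" using ij by auto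
    then obtain Z where Z: "Z \<in> proper_cyclic_flats" "r A = r Z + card (A - Z)"
      using mrank_via_cyclic_flat[OF A(1)] by blast
    have "card (A - Z) + j = k - r Z" using A Z \<open>r A < k\<close> by linarith
    moreover have "card (A \<inter> Z) = r Z + i" using split[OF A(1), of Z] A Z \<open>r A < card A\<close> by linarith
    ultimately show "A \<in> (\<Union>H\<in>proper_cyclic_flats. ?S H)" using Z A by blast
  next
    fix A assume "A \<in> (\<Union>H\<in>proper_cyclic_flats. ?S H)"
    then obtain H where H: "H \<in> proper_cyclic_flats"
      and A: "A \<subseteq> E" "card (A \<inter> H) = r H + i" "card (A - H) + j = k - r H" by blast
    have fin: "finite A" using A finite_subset by blast
    have "r A \<le> r (H \<union> A)" by (rule mrank_mono) auto
    hence le: "r A \<le> r H + card (A - H)" using mrank_Un_le[OF fin, of H] by linarith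
    have lt: "r H + card (A - H) < k" using A ij by linarith
    have dep: "r A < card A" using le A ij split[OF A(1), of H] by linarith
    obtain Z where Z: "Z \<in> proper_cyclic_flats" "r A = r Z + card (A - Z)"
      using mrank_via_cyclic_flat[OF A(1) _ dep] order.strict_trans1[OF le lt] by blast
    have "r Z < card (A \<inter> Z)" using Z dep split[OF A(1), of Z] by linarith
    hence "H = Z" using cyclic_flat_unique[OF es fin H lt Z(1)] by blast
    hence "r A = r H + card (A - H)" using Z by simp
    thus "A \<in> {A. A \<subseteq> E \<and> k - r A = j \<and> card A - r A = i}"
      using A split[OF A(1), of H] lt by simp
  qed
  moreover have "card (\<Union>H\<in>proper_cyclic_flats. ?S H) = (\<Sum>H\<in>proper_cyclic_flats. card (?S H))"
  proof (rule card_UN_disjoint[OF finite_proper_cyclic_flats]; intro ballI impI)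
    fix H Z assume H: "H \<in> proper_cyclic_flats" "Z \<in> proper_cyclic_flats" "H \<noteq> Z"
    have "H = Z" if A: "A \<in> ?S H" "A \<in> ?S Z" for A
      using H A ij finite_subset[of A E] by (intro cyclic_flat_unique[OF es, of A H Z]) auto
    thus "?S H \<inter> ?S Z = {}" using H(3) by blast
  qed simp
  moreover have "int (card (?S H)) = flat_count n k (k - r H, card H - r H) (j, i)"
    if H: "H \<in> proper_cyclic_flats" for H
  proof -
    have rk: "r H < k" "r H < card H" and sub: "H \<subseteq> E" using H unfolding proper_cyclic_flats_def by auto
    have fin: "finite H" using sub finite_subset by blast
    show ?thesis
    proof (cases "j \<le> k - r H")
      case True
      hence "?S H = {A. A \<subseteq> E \<and> card (A \<inter> H) = r H + i \<and> card (A - H) = k - r H - j}" by auto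
      hence "card (?S H) = (card H choose (r H + i)) * (card (E - H) choose (k - r H - j))"
        using card_subsets_split[OF _ sub] by simp
      moreover have "card (E - H) = n - card H" using sub fin by (simp add: card_Diff_subset)
      ultimately show ?thesis using True rk by (simp add: flat_count_def)
    next
      case False
      hence "?S H = {}" by auto
      thus ?thesis using False by (simp add: flat_count_def)
    qed
  qed
  ultimately show ?thesis by simp
qed

text \<open>Makes the coefficient at corank \<open>k\<close> and nullity 0 equal to 1 for every
  matroid of rank \<open>k\<close>, which supplies the constant term of an invariant.\<close>

lemma corank_zero_count: "{A. A \<subseteq> E \<and> k - r A = k \<and> card A - r A = 0} = {{}}"
proof -
  have "A = {}" if "A \<subseteq> E" "k - r A = k" "card A - r A = 0" for A
  proof -
    have "r A = 0" using that(2) mrank_le[of A] by linarith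
    thus ?thesis using that finite_subset[OF that(1)] by simp
  qed
  moreover have "r {} = 0" using mrank_le_card[of "{}"] by simp
  ultimately show ?thesis by auto
qed

end

text \<open>Forward substitution for a system whose matrix is triangular for the componentwise
  order. With unit diagonal no division occurs, so it works in any abelian group.\<close>

function unitriangular_solution :: "(nat \<times> nat \<Rightarrow> nat \<times> nat \<Rightarrow> int) \<Rightarrow> (nat \<times> nat \<Rightarrow> 'b) \<Rightarrow> nat \<times> nat \<Rightarrow> 'b :: ab_group_add" where
  "unitriangular_solution C G q = G q - (\<Sum>p\<in>{1..fst q} \<times> {1..snd q} - {q}. zsmul (C q p) (unitriangular_solution C G p))"
  by auto
termination
  \<comment> \<open>Every other \<open>p\<close> in the box below \<open>q\<close> has a smaller
    coordinate sum.\<close>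
  by (relation "Wellfounded.measure (\<lambda>(C, G, q). fst q + snd q)") (auto simp: less_le_not_le)

declare unitriangular_solution.simps [simp del]

lemma unitriangular_solution_correct:
  assumes "C q q = 1" "1 \<le> fst q" "1 \<le> snd q"
  shows "(\<Sum>p\<in>{1..fst q} \<times> {1..snd q}. zsmul (C q p) (unitriangular_solution C G p)) = G q"
proof -
  have "q \<in> {1..fst q} \<times> {1..snd q}" using assms by (cases q) auto
  hence "(\<Sum>p\<in>{1..fst q} \<times> {1..snd q}. zsmul (C q p) (unitriangular_solution C G p)) =
      zsmul (C q q) (unitriangular_solution C G q) + (\<Sum>p\<in>{1..fst q} \<times> {1..snd q} - {q}. zsmul (C q p) (unitriangular_solution C G p))"
    by (intro sum.remove) auto
  thus ?thesis using assms(1) by (subst (asm) unitriangular_solution.simps[of C G q]) simp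
qed

lemma tutte_universal:
  assumes f: "valuative_invariant f"
  shows "valuatively_universal_within tutte elementary_split f"
  unfolding valuatively_universal_within_def
proof (intro allI impI)
  fix n k :: nat assume kn: "k \<le> n"
  define u where "u = f n (cut_matroid n k {} 0)"
  \<comment> \<open>The contribution of a flat of corank \<open>J\<close> and nullity
    \<open>I\<close>, taken at the initial segment of the same size.\<close>
  define G where "G = (\<lambda>(J, I). f n (cut_matroid n k {0..<k - J + I} (k - J)) - u)"
  define v where "v = unitriangular_solution (flat_count n k) G"
  \<comment> \<open>The coefficient at \<open>(k, 0)\<close> carries the value on the uniform
    matroid; the remaining ones are weighted by the solution \<open>v\<close>.\<close>
  define h where "h = (\<lambda>p. zsmul (corank_nullity_coeff k 0 p) u +
    (\<Sum>q\<in>{1..k} \<times> {1..n}. zsmul (corank_nullity_coeff (fst q) (snd q) p) (v q)))"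
  have "h (p + q) = h p + h q" for p q
    by (simp add: h_def corank_nullity_coeff_add zsmul_add_left sum.distrib algebra_simps)
  moreover have "f n B = h (tutte n B)" if B: "B \<in> matroids n k" and es: "elementary_split n B" for B
  proof -
    interpret matroid_on n k B using B by unfold_locales
    let ?q = "\<lambda>H. (k - r H, card H - r H)"
    have flat: "(\<Sum>p\<in>{1..k} \<times> {1..n}. zsmul (flat_count n k (?q H) p) (v p)) =
        f n (cut_matroid n k H (r H)) - u" if H: "H \<in> proper_cyclic_flats" for H
    proof -
      have rk: "r H < k" "r H < card H" and sub: "H \<subseteq> E" using H unfolding proper_cyclic_flats_def by auto
      have cardH: "card H \<le> n" using sub card_mono[of E H] by simp
      \<comment> \<open>The row of \<open>?q H\<close> vanishes outside the box below it, which
        reduces the full sum to the one solved by the recursion.\<close>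
      have zero: "flat_count n k (?q H) (j, i) = 0" if "k - r H < j \<or> card H - r H < i" for j i
      proof (cases "k - r H < j")
        case False
        hence "card H < r H + i" using that by linarith
        thus ?thesis using rk by (simp add: flat_count_def binomial_eq_0)
      qed (simp add: flat_count_def)
      have "(\<Sum>p\<in>{1..k} \<times> {1..n}. zsmul (flat_count n k (?q H) p) (v p)) =
          (\<Sum>p\<in>{1..fst (?q H)} \<times> {1..snd (?q H)}. zsmul (flat_count n k (?q H) p) (v p))"
      proof (rule sum.mono_neutral_right)
        show "\<forall>p\<in>{1..k} \<times> {1..n} - {1..fst (?q H)} \<times> {1..snd (?q H)}.
            zsmul (flat_count n k (?q H) p) (v p) = 0"
        proof
          fix p assume p: "p \<in> {1..k} \<times> {1..n} - {1..fst (?q H)} \<times> {1..snd (?q H)}"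
          obtain j i where "p = (j, i)" by fastforce
          hence "flat_count n k (?q H) p = 0" using p zero[of j i] by auto
          thus "zsmul (flat_count n k (?q H) p) (v p) = 0" by simp
        qed
      qed (use cardH in auto)
      also have "\<dots> = G (?q H)"
        unfolding v_def
      proof (rule unitriangular_solution_correct)
        \<comment> \<open>On the diagonal both binomial coefficients are 1: a full choice and an
          empty one.\<close>
        show "flat_count n k (?q H) (?q H) = 1" by (simp add: flat_count_def)
      qed (use rk in auto)
      also have "\<dots> = f n (cut_matroid n k {0..<card H} (r H)) - u"
        using rk by (simp add: G_def)
      also have "\<dots> = f n (cut_matroid n k H (r H)) - u"
        using invariant_cut_matroid[OF f cut_matroid_nonempty sub] by simp
      finally show ?thesis .
    qed
    have count: "corank_nullity_coeff (fst p) (snd p) (tutte n B) =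
        (\<Sum>H\<in>proper_cyclic_flats. flat_count n k (?q H) p)" if "p \<in> {1..k} \<times> {1..n}" for p
      using that corank_nullity_count[OF es, of "fst p" "snd p"]
      unfolding corank_nullity_coeff_tutte mrank_ground by auto
    have "corank_nullity_coeff k 0 (tutte n B) = 1"
      unfolding corank_nullity_coeff_tutte mrank_ground corank_zero_count by simp
    hence "h (tutte n B) = u + (\<Sum>p\<in>{1..k} \<times> {1..n}. \<Sum>H\<in>proper_cyclic_flats.
        zsmul (flat_count n k (?q H) p) (v p))"
      unfolding h_def by (simp add: count zsmul_sum_left cong: sum.cong)
    also have "\<dots> = u + (\<Sum>H\<in>proper_cyclic_flats. f n (cut_matroid n k H (r H)) - u)"
      by (subst sum.swap) (simp only: flat cong: sum.cong)
    also have "\<dots> = u - (\<Sum>H\<in>proper_cyclic_flats. u - f n (cut_matroid n k H (r H)))"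
      by (simp add: sum_subtractf)
    also have "\<dots> = f n B"
    proof -
      have "valuative_on n k (f n)" using f kn unfolding valuative_invariant_def by blast
      from valuation_formula[OF es this] show ?thesis unfolding u_def by simp
    qed
    finally show ?thesis by simp
  qed
  ultimately show "\<exists>h. (\<forall>p q. h (p + q) = h p + h q) \<and>
      (\<forall>B\<in>matroids n k. elementary_split n B \<longrightarrow> f n B = h (tutte n B))" by blast
qed

theorem theoremB:
  shows "valuative_invariant tutte \<and>
    (\<forall>f :: nat \<Rightarrow> nat set set \<Rightarrow> 'b::ab_group_add. valuative_invariant f \<longrightarrow>
       valuatively_universal_within tutte elementary_split f)"
  using valuative_invariant_tutte tutte_universal by blast

end
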